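(* Over polytopes with $n$ vertices, the maximum number of combinatorially distinct cut trees consisting only of polytope edges (edge-unfolding cut trees) is $2^{O(n)}$, and the maximum number of (arbitrary) combinatorially distinct cut trees is $2^{O(n^2)}$.
   Context: A polytope is a convex polyhedron. A geometric cut tree $\mathcal{T}_C$ for $Q$ is a tree drawn on $\partial Q$, each arc a polygonal path, such that cutting $\partial Q$ along $\mathcal{T}_C$ and flattening $\partial Q\setminus\mathcal{T}_C$ into the plane yields a simple polygon; an edge-unfolding cut tree is one consisting of edges of $Q$. The combinatorial cut tree $T_C$ of $\mathcal{T}_C$ is the labeled graph with a node for each point of $\mathcal{T}_C$ of degree not equal to 2 and a node for each point of $\mathcal{T}_C$ at a vertex of $Q$ (labeled by that vertex); arcs are the polygonal paths of $\mathcal{T}_C$ connecting these nodes. Cut trees are combinatorially distinct when their combinatorial cut trees differ as labeled trees. *)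

theory Defs
  imports "HOL-Analysis.Analysis"
begin

definition vertices_of :: "(real^3) set \<Rightarrow> (real^3) set" where
  "vertices_of Q = {v. v extreme_point_of Q}"

definition edges_of :: "(real^3) set \<Rightarrow> (real^3) set set" where
  "edges_of Q = {e. e face_of Q \<and> aff_dim e = 1}"

definition polygonal_set :: "('a::real_normed_vector) set \<Rightarrow> bool" where
  "polygonal_set T \<longleftrightarrow>
     (\<exists>S. finite S \<and> (\<forall>s\<in>S. \<exists>a b. s = closed_segment a b) \<and> T = \<Union>S)"

definition simple_polygon :: "(real^2) set \<Rightarrow> bool" where
  "simple_polygon P \<longleftrightarrow>
     (\<exists>g. simple_path g \<and> pathfinish g = pathstart g \<and> polygonal_set (path_image g)
          \<and> P = path_image g \<union> inside (path_image g))"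

text \<open>Cutting the boundary of Q along T and flattening yields a simple polygon P:
  there is a continuous map from P onto the boundary of Q, injective on the interior
  of P with the interior mapped onto (boundary Q - T), the boundary of P mapped onto T,
  and which is piecewise an isometry into the faces of Q (finitely many pieces).\<close>
definition unfolds_to_simple_polygon :: "(real^3) set \<Rightarrow> (real^3) set \<Rightarrow> bool" where
  "unfolds_to_simple_polygon Q T \<longleftrightarrow>
     (\<exists>P f. simple_polygon P \<and> continuous_on P f \<and> f ` P = frontier Q
        \<and> f ` frontier P = T \<and> inj_on f (interior P) \<and> f ` interior P \<inter> T = {}
        \<and> (\<exists>Ps. finite Ps \<and> \<Union>Ps = P \<and>
              (\<forall>X\<in>Ps. (\<exists>F. F face_of Q \<and> aff_dim F = 2 \<and> f ` X \<subseteq> F)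
                      \<and> (\<forall>x\<in>X. \<forall>y\<in>X. dist (f x) (f y) = dist x y))))"

definition cut_tree :: "(real^3) set \<Rightarrow> (real^3) set \<Rightarrow> bool" where
  "cut_tree Q T \<longleftrightarrow>
     T \<noteq> {} \<and> T \<subseteq> frontier Q \<and> polygonal_set T \<and> connected T
     \<and> \<not> (\<exists>g. simple_path g \<and> pathfinish g = pathstart g \<and> path_image g \<subseteq> T)
     \<and> unfolds_to_simple_polygon Q T"

definition edge_cut_tree :: "(real^3) set \<Rightarrow> (real^3) set \<Rightarrow> bool" where
  "edge_cut_tree Q T \<longleftrightarrow> cut_tree Q T \<and> (\<exists>E. E \<subseteq> edges_of Q \<and> T = \<Union>E)"

definition tdeg :: "(real^3) set \<Rightarrow> real^3 \<Rightarrow> nat" where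
  "tdeg T x = (THE k. \<exists>e>0. \<forall>r. 0 < r \<and> r < e \<longrightarrow>
                  card (components ((T \<inter> ball x r) - {x})) = k)"

definition ct_nodes :: "(real^3) set \<Rightarrow> (real^3) set \<Rightarrow> (real^3) set" where
  "ct_nodes Q T = {x \<in> T. tdeg T x \<noteq> 2 \<or> x \<in> vertices_of Q}"

definition ct_adj :: "(real^3) set \<Rightarrow> (real^3) set \<Rightarrow> real^3 \<Rightarrow> real^3 \<Rightarrow> bool" where
  "ct_adj Q T x y \<longleftrightarrow> x \<in> ct_nodes Q T \<and> y \<in> ct_nodes Q T \<and> x \<noteq> y \<and>
     (\<exists>g. arc g \<and> pathstart g = x \<and> pathfinish g = y \<and> path_image g \<subseteq> T
          \<and> path_image g \<inter> ct_nodes Q T \<subseteq> {x, y})"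

definition ct_label :: "(real^3) set \<Rightarrow> real^3 \<Rightarrow> (real^3) option" where
  "ct_label Q x = (if x \<in> vertices_of Q then Some x else None)"

definition comb_equiv :: "(real^3) set \<Rightarrow> (real^3) set \<Rightarrow> (real^3) set \<Rightarrow> bool" where
  "comb_equiv Q T1 T2 \<longleftrightarrow>
     (\<exists>h. bij_betw h (ct_nodes Q T1) (ct_nodes Q T2)
        \<and> (\<forall>x\<in>ct_nodes Q T1. \<forall>y\<in>ct_nodes Q T1. ct_adj Q T1 x y \<longleftrightarrow> ct_adj Q T2 (h x) (h y))
        \<and> (\<forall>x\<in>ct_nodes Q T1. ct_label Q (h x) = ct_label Q x))"

end

theory Submission
  imports Defs
begin

text \<open>An edge cut tree is a union of edges, so for the first bound it suffices that a 3-polytope with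
  \<open>n\<close> vertices has \<open>O(n)\<close> edges. Choose a linear functional that is injective on the vertices.
  Every 2-face has a vertex that is neither its lowest nor its highest one, and a vertex \<open>w\<close> plays this
  role for at most two faces: these faces cut the horizontal slice through \<open>w\<close>, a planar convex set, in
  edges with endpoint \<open>w\<close>.

  For the second bound, every leaf of a cut tree is a vertex of the polytope: cutting along a dangling
  arc that ends at a flat point would unfold to a polygon with full angle at a boundary point. In a tree
  there are at most as many branch points as leaves, so a combinatorial cut tree has \<open>O(n)\<close> nodes,
  and a labelled graph on \<open>O(n)\<close> nodes is one of \<open>2 ^ O(n^2)\<close>.\<close>

section \<open>Edges of a 3-polytope\<close>

text \<open>Being a tree is a topological condition here (no simple loop inside \<open>T\<close>),
  while the count needs a finite graph. That graph lives on the irregular points of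
  \<open>T\<close>, where \<open>T\<close> is not locally a straight line; bends are included so
  that its edges are segments, and a graph cycle then yields a forbidden loop. The unfolding is only
  a continuous map that is isometric on finitely many sets of arbitrary shape, so angles at a
  boundary point of the polygon are awkward to speak of, and area takes their place: with the pieces
  closed up, the map followed by a chart of the surface cannot increase area, while a disc about a
  point that is not interior to the polygon meets it in less than full area. The constant 6 is two
  faces per vertex times three segments per face. The constant 12 comes from at most 2n+1 \<le> 3n
  names for nodes: a set of names and a relation on them leave at most 2 to the power 3n + 9n^2
  choices.\<close>

lemma face_Int_convex_hull:
  fixes P :: "'a::euclidean_space set"
  assumes e: "e face_of P" and P: "convex P" and B: "finite B" "B \<subseteq> P"
    and q: "q \<in> e" "q \<in> convex hull B"
  shows "q \<in> convex hull (B \<inter> e)"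
proof -
  have sub: "convex hull B \<subseteq> P" using B(2) P by (simp add: hull_minimal)
  \<comment> \<open>Slicing makes \<open>e\<close> a face of \<open>convex hull B\<close>, and a
    face of the hull of a compact set is the hull of a subset of it.\<close>
  have "(e \<inter> convex hull B) face_of (P \<inter> convex hull B)"
    by (rule face_of_slice[OF e convex_convex_hull])
  then have "(e \<inter> convex hull B) face_of (convex hull B)"
    using sub by (simp add: inf.absorb2)
  then obtain S' where S': "S' \<subseteq> B" "e \<inter> convex hull B = convex hull S'"
    using face_of_convex_hull_subset[OF finite_imp_compact[OF B(1)]] by metis
  have "S' \<subseteq> B \<inter> e" using S' hull_subset[of S' convex] by blast
  then show ?thesis using q S'(2) hull_mono[of S' "B \<inter> e" convex] by blast
qed

text \<open>Two points already give \<open>e \<inter> f\<close> dimension one, and a proper face has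
  smaller dimension.\<close>

lemma one_dim_face_eqI:
  fixes P :: "'a::euclidean_space set"
  assumes P: "convex P" and e: "e face_of P" "aff_dim e = 1" and f: "f face_of P" "aff_dim f = 1"
    and w: "w \<in> e" "w \<in> f" and b: "b \<in> e" "b \<in> f" and ne: "b \<noteq> w"
  shows "e = f"
proof -
  have "aff_dim {w, b} = 1" using ne by (simp add: aff_dim_2)
  then have d: "aff_dim (e \<inter> f) \<ge> 1" using w b aff_dim_subset[of "{w,b}" "e \<inter> f"] by simp
  have ef: "(e \<inter> f) face_of P" by (rule face_of_Int[OF e(1) f(1)])
  have "(e \<inter> f) face_of e" using ef e(1) face_of_imp_subset face_of_subset by (metis inf_le1)
  then have 1: "e \<inter> f = e"
    using face_of_aff_dim_lt[of e "e \<inter> f"] face_of_imp_convex[OF e(1)] d e(2) by force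
  have "(e \<inter> f) face_of f" using ef f(1) face_of_imp_subset face_of_subset by (metis inf_le2)
  then have 2: "e \<inter> f = f"
    using face_of_aff_dim_lt[of f "e \<inter> f"] face_of_imp_convex[OF f(1)] d f(2) by force
  show ?thesis using 1 2 by simp
qed

lemma ex_other_point:
  fixes e :: "'a::euclidean_space set"
  assumes "aff_dim e \<ge> 1" obtains b where "b \<in> e" "b \<noteq> w"
proof -
  have "\<not> e \<subseteq> {w}" using assms aff_dim_subset[of e "{w}"] by auto
  then show ?thesis using that by blast
qed

text \<open>Radon's theorem for \<open>w\<close> and one further point on each edge: four points in
  dimension at most two split into two sets whose hulls meet. Each split is excluded because, if a
  face contains one of the sets, the common point is already in the hull of those points of the
  other set that lie in the face.\<close>

lemma no_three_edges:
  fixes P :: "'a::euclidean_space set"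
  assumes P: "convex P" "aff_dim P \<le> 2" and w: "w extreme_point_of P"
    and e1: "e1 face_of P" "aff_dim e1 = 1" "w \<in> e1"
    and e2: "e2 face_of P" "aff_dim e2 = 1" "w \<in> e2"
    and e3: "e3 face_of P" "aff_dim e3 = 1" "w \<in> e3"
    and ne: "e1 \<noteq> e2" "e1 \<noteq> e3" "e2 \<noteq> e3"
  shows False
proof -
  obtain b1 where b1: "b1 \<in> e1" "b1 \<noteq> w" using ex_other_point[of e1] e1 by auto
  obtain b2 where b2: "b2 \<in> e2" "b2 \<noteq> w" using ex_other_point[of e2] e2 by auto
  obtain b3 where b3: "b3 \<in> e3" "b3 \<noteq> w" using ex_other_point[of e3] e3 by auto
  have n: "b1 \<notin> e2" "b1 \<notin> e3" "b2 \<notin> e1" "b2 \<notin> e3" "b3 \<notin> e1" "b3 \<notin> e2"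
    using one_dim_face_eqI[OF P(1) e1(1,2) e2(1,2) e1(3) e2(3)]
      one_dim_face_eqI[OF P(1) e1(1,2) e3(1,2) e1(3) e3(3)]
      one_dim_face_eqI[OF P(1) e2(1,2) e3(1,2) e2(3) e3(3)] b1 b2 b3 ne by metis+
  let ?C = "{w,b1,b2,b3}"
  have dist: "b1 \<noteq> b2" "b1 \<noteq> b3" "b2 \<noteq> b3" using n b1 b2 b3 by auto
  have CP: "?C \<subseteq> P"
    using b1 b2 b3 e1 e2 e3 face_of_imp_subset by blast
  have card: "card ?C = 4" using dist b1 b2 b3 by (simp add: eq_commute)
  have "aff_dim ?C \<le> 2" using aff_dim_subset[OF CP] P(2) by simp
  then have "affine_dependent ?C" using affine_independent_iff_card[of ?C] card by auto
  then obtain M N where MN: "M \<inter> N = {}" "M \<union> N = ?C" "convex hull M \<inter> convex hull N \<noteq> {}"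
    using Radon_partition[of ?C] by auto
  \<comment> \<open>The side containing \<open>w\<close> is called \<open>M\<close>. Either it has
    at most two points (\<open>edge\<close>) or \<open>N\<close> has at most one
    (\<open>fin\<close>).\<close>
  have *: False if MN: "M \<inter> N = {}" "M \<union> N = ?C" "convex hull M \<inter> convex hull N \<noteq> {}" "w \<in> M" for M N
  proof -
    obtain q where q: "q \<in> convex hull M" "q \<in> convex hull N" using MN by auto
    have sub: "M \<subseteq> P" "N \<subseteq> P" "finite M" "finite N"
      using MN CP by (auto intro: finite_subset[of _ ?C])
    have wf: "{w} face_of P" using w by (simp add: face_of_singleton)
    have wN: "w \<notin> N" using MN by auto
    have inN: "q \<in> convex hull (N \<inter> e)" if "e face_of P" "M \<subseteq> e" for e
    proof -
      have "q \<in> e" using q(1) that hull_minimal[of M e convex] face_of_imp_convex by blast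
      then show ?thesis by (rule face_Int_convex_hull[OF that(1) P(1) sub(4,2) _ q(2)])
    qed
    have inM: "q \<in> convex hull (M \<inter> e)" if "e face_of P" "N \<subseteq> e" for e
    proof -
      have "q \<in> e" using q(2) that hull_minimal[of N e convex] face_of_imp_convex by blast
      then show ?thesis by (rule face_Int_convex_hull[OF that(1) P(1) sub(3,1) _ q(1)])
    qed
    have nN: "N \<noteq> {}" using q by auto
    have h1: "\<not> M \<subseteq> {w}" using inN[OF wf] wN by auto
    have edge: "\<not> M \<subseteq> {w,b}" if "e face_of P" "w \<in> e" "b \<in> e" "\<And>c. c \<in> {b1,b2,b3} \<Longrightarrow> c \<in> e \<Longrightarrow> c = b" for e b
    proof
      assume M: "M \<subseteq> {w,b}"
      then have "b \<in> M" using h1 MN(4) by blast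
      then have "N \<inter> e = {}" using MN that by auto
      then show False using inN[of e] M that by auto
    qed
    have fin: "\<not> N \<subseteq> {b}" if "e face_of P" "w \<in> e" "b \<in> e" "b \<noteq> w" "\<And>c. c \<in> {b1,b2,b3} \<Longrightarrow> c \<in> e \<Longrightarrow> c = b" for e b
    proof
      assume N: "N \<subseteq> {b}"
      then have "N = {b}" using nN by auto
      \<comment> \<open>Here the common point is forced to be both \<open>w\<close> and
        \<open>b\<close>.\<close>
      then have "M \<inter> e = {w}" using MN that by auto
      then have "q = w" using inM[of e] N that by auto
      moreover have "q = b" using q(2) \<open>N = {b}\<close> by auto
      ultimately show False using that by auto
    qed
    have "\<not> M \<subseteq> {w,b1}" by (rule edge[OF e1(1,3) b1(1)]) (use n in auto)
    moreover have "\<not> M \<subseteq> {w,b2}" by (rule edge[OF e2(1,3) b2(1)]) (use n in auto)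
    moreover have "\<not> M \<subseteq> {w,b3}" by (rule edge[OF e3(1,3) b3(1)]) (use n in auto)
    moreover have "\<not> N \<subseteq> {b1}" by (rule fin[OF e1(1,3) b1]) (use n in auto)
    moreover have "\<not> N \<subseteq> {b2}" by (rule fin[OF e2(1,3) b2]) (use n in auto)
    moreover have "\<not> N \<subseteq> {b3}" by (rule fin[OF e3(1,3) b3]) (use n in auto)
    moreover have "M \<subseteq> {w,b1} \<or> M \<subseteq> {w,b2} \<or> M \<subseteq> {w,b3} \<or> N \<subseteq> {b1} \<or> N \<subseteq> {b2} \<or> N \<subseteq> {b3}"
      using MN(1,2) wN by (cases "b1 \<in> M"; cases "b2 \<in> M"; cases "b3 \<in> M") auto
    ultimately show False by simp
  qed
  have "w \<in> M \<or> w \<in> N" using MN(2) by auto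
  moreover have "w \<in> N \<Longrightarrow> False"
    using *[of N M] MN by (metis Int_commute Un_commute)
  ultimately show False using *[OF MN] by blast
qed

lemma card_le_two:
  assumes "\<And>a b c. a \<in> A \<Longrightarrow> b \<in> A \<Longrightarrow> c \<in> A \<Longrightarrow> a \<noteq> b \<Longrightarrow> a \<noteq> c \<Longrightarrow> b \<noteq> c \<Longrightarrow> False"
  shows "finite A \<and> card A \<le> 2"
proof (rule ccontr)
  assume "\<not> (finite A \<and> card A \<le> 2)"
  then obtain B where B: "B \<subseteq> A" "finite B" "card B = 3"
    by (metis infinite_arbitrarily_large not_less_eq_eq numeral_2_eq_2 numeral_3_eq_3 obtain_subset_with_card_n)
  then obtain a b c where "B = {a,b,c}" "a \<noteq> b" "a \<noteq> c" "b \<noteq> c" by (auto simp: card_3_iff)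
  then show False using assms[of a b c] B(1) by auto
qed

lemma edges_at_vertex:
  fixes P :: "'a::euclidean_space set"
  assumes "convex P" "aff_dim P \<le> 2" "w extreme_point_of P"
  shows "finite {e. e face_of P \<and> aff_dim e = 1 \<and> w \<in> e}"
    and "card {e. e face_of P \<and> aff_dim e = 1 \<and> w \<in> e} \<le> 2"
  using card_le_two[of "{e. e face_of P \<and> aff_dim e = 1 \<and> w \<in> e}"] no_three_edges[OF assms]
  by blast+

section \<open>Charging edges to vertices and faces by a generic height\<close>

text \<open>Only functionals orthogonal to one of finitely many nonzero differences fail, and
  finitely many hyperplanes, being null sets, do not fill the space.\<close>

lemma ex_injective_functional:
  fixes V :: "'a::euclidean_space set"
  assumes "finite V"
  obtains l where "inj_on (\<lambda>x. l \<bullet> x) V"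
proof -
  let ?D = "{p \<in> V \<times> V. fst p \<noteq> snd p}"
  have "negligible (\<Union>p\<in>?D. {l. (fst p - snd p) \<bullet> l = 0})"
    by (rule negligible_Union) (use assms in \<open>auto intro!: negligible_hyperplane\<close>)
  then have "(\<Union>p\<in>?D. {l. (fst p - snd p) \<bullet> l = 0}) \<noteq> UNIV"
    using non_negligible_UNIV by metis
  then obtain l where l: "\<And>p. p \<in> ?D \<Longrightarrow> (fst p - snd p) \<bullet> l \<noteq> 0" by blast
  have "inj_on (\<lambda>x. l \<bullet> x) V"
  proof (rule inj_onI, rule ccontr)
    fix x y assume *: "x \<in> V" "y \<in> V" "l \<bullet> x = l \<bullet> y" "x \<noteq> y"
    then show False using l[of "(x,y)"] by (simp add: inner_diff_left inner_diff_right inner_commute)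
  qed
  then show ?thesis using that by blast
qed

lemma extreme_point_not_between:
  assumes "w extreme_point_of P" "u \<in> P" "v \<in> P" "w \<noteq> u" "w \<noteq> v"
  shows "w \<notin> closed_segment u v"
  using assms by (auto simp: extreme_point_of_def closed_segment_eq_open)

text \<open>Slicing loses no face: two faces with the same slice share the crossing point of a
  segment from below to above \<open>w\<close>, hence, being faces, its ends; together with
  \<open>w\<close> these span a triangle, so the faces coincide.\<close>

lemma crossing_faces:
  fixes Q :: "'a::euclidean_space set" and l :: 'a
  assumes Q: "convex Q" "aff_dim Q = 3" and w: "w extreme_point_of Q" and DIM: "DIM('a) = 3"
  defines "NF \<equiv> {F. F face_of Q \<and> aff_dim F = 2 \<and> w \<in> F \<and>
     (\<exists>u v. u extreme_point_of Q \<and> v extreme_point_of Q \<and> u \<in> F \<and> v \<in> F \<and> l \<bullet> u < l \<bullet> w \<and> l \<bullet> w < l \<bullet> v)}"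
  shows "finite NF \<and> card NF \<le> 2"
proof (cases "NF = {}")
  case False
  then have l0: "l \<noteq> 0" unfolding NF_def by auto
  let ?H = "{y. l \<bullet> y = l \<bullet> w}"
  let ?E = "{e. e face_of (Q \<inter> ?H) \<and> aff_dim e = 1 \<and> w \<in> e}"
  have cH: "convex ?H" by (rule convex_hyperplane)
  have "aff_dim ?H = 2" using l0 DIM by simp
  then have d: "aff_dim (Q \<inter> ?H) \<le> 2" using aff_dim_subset[of "Q \<inter> ?H" ?H] by simp
  have wE: "w extreme_point_of (Q \<inter> ?H)" using w by (auto simp: extreme_point_of_def)
  have cQH: "convex (Q \<inter> ?H)" using Q cH by (simp add: convex_Int)
  \<comment> \<open>\<open>p\<close> is where the segment from \<open>u\<close> to \<open>v\<close>
    passes the height of \<open>w\<close>. An extreme point is never between two others, which gives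
    both \<open>p \<noteq> w\<close> and the dimension of \<open>{u,v,w}\<close>.\<close>
  have key: "\<exists>p u v. p \<in> F \<inter> ?H \<and> p \<noteq> w \<and> u \<in> F \<and> v \<in> F \<and> p \<in> open_segment u v \<and> aff_dim {u,v,w} = 2"
    if FN: "F \<in> NF" for F
  proof -
    obtain u v where uv: "u extreme_point_of Q" "v extreme_point_of Q" "u \<in> F" "v \<in> F"
        "l \<bullet> u < l \<bullet> w" "l \<bullet> w < l \<bullet> v"
      and F: "F face_of Q" "w \<in> F" using FN unfolding NF_def by blast
    define t where "t = (l \<bullet> w - l \<bullet> u) / (l \<bullet> v - l \<bullet> u)"
    define p where "p = (1 - t) *\<^sub>R u + t *\<^sub>R v"
    have t: "0 < t" "t < 1" using uv by (auto simp: t_def field_simps)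
    have uv': "u \<noteq> v" "w \<noteq> u" "w \<noteq> v" using uv by auto
    have po: "p \<in> open_segment u v" using t uv' by (auto simp: in_segment p_def)
    have "l \<bullet> p = l \<bullet> w"
    proof -
      have "l \<bullet> p = l \<bullet> u + t * (l \<bullet> v - l \<bullet> u)" by (simp add: p_def inner_right_distrib algebra_simps)
      also have "\<dots> = l \<bullet> w" using uv by (simp add: t_def)
      finally show ?thesis .
    qed
    moreover have pF: "p \<in> F"
      using po uv face_of_imp_convex[OF F(1)] by (meson convex_contains_open_segment subsetD)
    moreover have "p \<noteq> w" using po extreme_point_not_between[OF w _ _ uv'(2,3)] uv
      by (auto simp: extreme_point_of_def open_segment_def)
    moreover have "aff_dim {u,v,w} = 2"
    proof -
      have "\<not> collinear {u,v,w}"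
      proof
        assume "collinear {u,v,w}"
        then have "u \<in> closed_segment v w \<or> v \<in> closed_segment u w \<or> w \<in> closed_segment u v"
          by (auto simp: collinear_between_cases between_mem_segment closed_segment_commute)
        then show False
          using extreme_point_not_between[of u Q v w] extreme_point_not_between[of v Q u w] extreme_point_not_between[of w Q u v] uv uv' w
          by (auto simp: extreme_point_of_def)
      qed
      then have "aff_dim {u,v,w} > 1" by (simp add: collinear_aff_dim)
      moreover have "card {u,v,w} = 3" using uv' by auto
      then have "aff_dim {u,v,w} \<le> 2" using aff_dim_le_card[of "{u,v,w}"] by simp
      ultimately show ?thesis by simp
    qed
    ultimately show ?thesis using po uv by blast
  qed
  have img: "(\<lambda>F. F \<inter> ?H) ` NF \<subseteq> ?E"
  proof (clarify)
    fix F assume F: "F \<in> NF"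
    then have Ff: "F face_of Q" "aff_dim F = 2" "w \<in> F" by (auto simp: NF_def)
    obtain p u v where p: "p \<in> F \<inter> ?H" "p \<noteq> w" using key[OF F] by blast
    have f: "(F \<inter> ?H) face_of (Q \<inter> ?H)" by (rule face_of_slice[OF Ff(1) cH])
    have "aff_dim {w,p} \<le> aff_dim (F \<inter> ?H)" by (rule aff_dim_subset) (use p Ff in auto)
    then have ge: "aff_dim (F \<inter> ?H) \<ge> 1" using p by (simp add: aff_dim_2)
    obtain u where u: "u \<in> F" "l \<bullet> u < l \<bullet> w" using F by (auto simp: NF_def)
    \<comment> \<open>\<open>u\<close> is a point of \<open>F\<close> strictly below the slicing
      plane, so adding it raises the dimension.\<close>
    have "aff_dim (F \<inter> ?H) < aff_dim F"
    proof -
      have "u \<notin> affine hull (F \<inter> ?H)"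
        using hull_minimal[of "F \<inter> ?H" ?H affine] affine_hyperplane[of l] u by auto
      then have "aff_dim (insert u (F \<inter> ?H)) = aff_dim (F \<inter> ?H) + 1"
        by (simp add: aff_dim_insert)
      moreover have "aff_dim (insert u (F \<inter> ?H)) \<le> aff_dim F" by (rule aff_dim_subset) (use u in auto)
      ultimately show ?thesis by simp
    qed
    then show "(F \<inter> ?H) face_of (Q \<inter> ?H) \<and> aff_dim (F \<inter> ?H) = 1 \<and> w \<in> F \<inter> ?H"
      using f ge Ff by auto
  qed
  have inj: "inj_on (\<lambda>F. F \<inter> ?H) NF"
  proof (rule inj_onI)
    fix F G assume F: "F \<in> NF" and G: "G \<in> NF" and eq: "F \<inter> ?H = G \<inter> ?H"
    obtain p u v where p: "p \<in> F \<inter> ?H" "u \<in> F" "v \<in> F" "p \<in> open_segment u v" "aff_dim {u,v,w} = 2"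
      using key[OF F] by blast
    have Ff: "F face_of Q" "aff_dim F = 2" "w \<in> F" and Gf: "G face_of Q" "aff_dim G = 2" "w \<in> G"
      using F G by (auto simp: NF_def)
    have "u \<in> G \<and> v \<in> G"
      using Gf(1) p eq face_of_imp_subset[OF Ff(1)] unfolding face_of_def by blast
    then have "aff_dim (F \<inter> G) \<ge> 2"
      using aff_dim_subset[of "{u,v,w}" "F \<inter> G"] p Ff Gf by simp
    moreover have fg: "(F \<inter> G) face_of Q" by (rule face_of_Int[OF Ff(1) Gf(1)])
    ultimately show "F = G"
      using face_of_aff_dim_lt[of F "F \<inter> G"] face_of_aff_dim_lt[of G "F \<inter> G"] Ff Gf
        face_of_subset[OF fg] face_of_imp_subset face_of_imp_convex
      by (metis inf_le1 inf_le2 linorder_not_less)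
  qed
  have fin: "finite ?E" "card ?E \<le> 2" using edges_at_vertex[OF cQH d wE] by auto
  show ?thesis
    using card_inj_on_le[OF inj img fin(1)] fin(2) inj_on_finite[OF inj img fin(1)] by linarith
qed auto

lemma finite_vertices_of: "polytope Q \<Longrightarrow> finite (vertices_of Q)"
  unfolding vertices_of_def
  by (rule finite_polyhedron_extreme_points) (rule polytope_imp_polyhedron)

lemma polytope_eq_hull_vertices: "polytope Q \<Longrightarrow> Q = convex hull (vertices_of Q)"
  unfolding vertices_of_def
  by (rule Krein_Milman_Minkowski) (auto simp: polytope_imp_compact polytope_imp_convex)

lemma vertices_of_face: "F face_of Q \<Longrightarrow> vertices_of F = vertices_of Q \<inter> F"
  by (auto simp: vertices_of_def extreme_point_of_face)

lemma edge_eq_segment: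
  assumes Q: "polytope Q" and e: "e \<in> edges_of Q"
  obtains a b where "a \<in> vertices_of Q" "b \<in> vertices_of Q" "a \<noteq> b" "e = closed_segment a b"
proof -
  have e: "e face_of Q" "aff_dim e = 1" using e by (auto simp: edges_of_def)
  have pe: "polytope e" by (rule face_of_polytope_polytope[OF Q e(1)])
  have "collinear e" using e(2) by (simp add: collinear_aff_dim)
  then obtain a b where ab: "e = closed_segment a b"
    using compact_convex_collinear_segment[of e] pe e(2)
    by (metis aff_dim_empty polytope_imp_compact polytope_imp_convex zero_neq_neg_one one_neq_neg_one)
  have "a \<noteq> b" using e(2) ab by auto
  moreover have "a extreme_point_of e" "b extreme_point_of e"
    using ab by (auto simp: extreme_point_of_segment)
  ultimately show ?thesis
    using that[of a b] ab extreme_point_of_face[OF e(1)] by (simp add: vertices_of_def)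
qed

lemma finite_edges_of: "polytope Q \<Longrightarrow> finite (edges_of Q)"
  unfolding edges_of_def by (rule finite_subset[OF _ finite_polytope_faces]) auto

text \<open>Edges of \<open>F\<close> avoiding all vertices of intermediate height join the lowest to the highest
  vertex of \<open>F\<close>, so there is at most one of them.\<close>

lemma card_edges_le:
  assumes Q: "polytope Q" "aff_dim Q = 3"
  shows "card (edges_of Q) \<le> 6 * card (vertices_of Q)"
proof -
  let ?V = "vertices_of Q"
  have fV: "finite ?V" using Q finite_vertices_of by blast
  have cQ: "convex Q" using Q polytope_imp_convex by blast
  obtain l where l: "inj_on (\<lambda>x. l \<bullet> x) ?V" using ex_injective_functional[OF fV] by blast
  \<comment> \<open>Each edge is charged to a vertex \<open>w\<close> and a face \<open>F\<close> in
    \<open>NF w\<close>: either it is an edge of \<open>F\<close> at \<open>w\<close>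
    (\<open>E1\<close>), or it is the segment from the lowest to the highest vertex of
    \<open>F\<close> (\<open>E2\<close>).\<close>
  define NF where "NF w = {F. F face_of Q \<and> aff_dim F = 2 \<and> w \<in> F \<and>
     (\<exists>u v. u extreme_point_of Q \<and> v extreme_point_of Q \<and> u \<in> F \<and> v \<in> F \<and> l \<bullet> u < l \<bullet> w \<and> l \<bullet> w < l \<bullet> v)}" for w
  define E1 where "E1 w F = {e. e face_of F \<and> aff_dim e = 1 \<and> w \<in> e}" for w :: "real^3" and F
  define E2 where "E2 F = {closed_segment a b |a b. a \<in> ?V \<inter> F \<and> b \<in> ?V \<inter> F \<and>
      (\<forall>c\<in>?V\<inter>F. l \<bullet> a \<le> l \<bullet> c \<and> l \<bullet> c \<le> l \<bullet> b)}" for F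
  have NF: "finite (NF w) \<and> card (NF w) \<le> 2" if "w \<in> ?V" for w
    unfolding NF_def by (rule crossing_faces) (use that Q cQ in \<open>auto simp: vertices_of_def\<close>)
  have E1: "finite (E1 w F) \<and> card (E1 w F) \<le> 2" if "w \<in> ?V" "F \<in> NF w" for w F
  proof -
    have F: "F face_of Q" "aff_dim F = 2" "w \<in> F" using that by (auto simp: NF_def)
    have "w extreme_point_of F" using extreme_point_of_face[OF F(1)] that F by (auto simp: vertices_of_def)
    then show ?thesis
      unfolding E1_def using edges_at_vertex[of F w] F face_of_imp_convex[OF F(1)] by auto
  qed
  have E2: "finite (E2 F) \<and> card (E2 F) \<le> 1" for F
  proof -
    have "e = e'" if ee: "e \<in> E2 F" "e' \<in> E2 F" for e e'
    proof -
      obtain a b where ab: "e = closed_segment a b" "a \<in> ?V \<inter> F" "b \<in> ?V \<inter> F"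
         "\<forall>c\<in>?V\<inter>F. l \<bullet> a \<le> l \<bullet> c \<and> l \<bullet> c \<le> l \<bullet> b" using ee(1) by (auto simp: E2_def)
      obtain a' b' where ab': "e' = closed_segment a' b'" "a' \<in> ?V \<inter> F" "b' \<in> ?V \<inter> F"
         "\<forall>c\<in>?V\<inter>F. l \<bullet> a' \<le> l \<bullet> c \<and> l \<bullet> c \<le> l \<bullet> b'" using ee(2) by (auto simp: E2_def)
      have "l \<bullet> a = l \<bullet> a'" "l \<bullet> b = l \<bullet> b'" using ab ab' by (meson order_antisym)+
      then have "a = a'" "b = b'" using l ab ab' by (auto dest: inj_onD)
      then show ?thesis using ab ab' by simp
    qed
    then have "E2 F = {} \<or> (\<exists>e. E2 F = {e})" by blast
    then show ?thesis by auto
  qed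
  have cover: "edges_of Q \<subseteq> (\<Union>w\<in>?V. \<Union>F\<in>NF w. E1 w F \<union> E2 F)"
  proof
    fix e assume e: "e \<in> edges_of Q"
    have ef: "e face_of Q" "aff_dim e = 1" using e by (auto simp: edges_of_def)
    obtain a b where ab: "a \<in> ?V" "b \<in> ?V" "a \<noteq> b" "e = closed_segment a b"
      using edge_eq_segment[OF Q(1) e] .
    have "e \<noteq> {}" "e \<noteq> Q" using ab ef Q by auto
    then obtain F where F: "F facet_of Q" "e \<subseteq> F"
      using face_of_polyhedron_subset_facet[OF polytope_imp_polyhedron[OF Q(1)] ef(1)] by blast
    have Ff: "F face_of Q" "aff_dim F = 2" using F Q by (auto simp: facet_of_def)
    have eF: "e face_of F" using ef(1) F Ff by (meson face_of_imp_subset face_of_subset)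
    let ?VF = "?V \<inter> F"
    have fVF: "finite ?VF" using fV by auto
    have "F = convex hull ?VF"
      using polytope_eq_hull_vertices[OF face_of_polytope_polytope[OF Q(1) Ff(1)]]
        vertices_of_face[OF Ff(1)] by simp
    then have "aff_dim ?VF = 2" using Ff(2) by (metis aff_dim_convex_hull)
    then have c3: "card ?VF \<ge> 3" using aff_dim_le_card[OF fVF] by simp
    have abF: "a \<in> ?VF" "b \<in> ?VF" "a \<in> e" "b \<in> e" using ab F by auto
    let ?mid = "\<lambda>w. w \<in> ?VF \<and> (\<exists>u v. u \<in> ?VF \<and> v \<in> ?VF \<and> l \<bullet> u < l \<bullet> w \<and> l \<bullet> w < l \<bullet> v)"
    have midNF: "F \<in> NF w" if "?mid w" for w
      using that Ff by (auto simp: NF_def vertices_of_def)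
    show "e \<in> (\<Union>w\<in>?V. \<Union>F\<in>NF w. E1 w F \<union> E2 F)"
    proof (cases "?mid a \<or> ?mid b")
      case True
      then obtain w where w: "?mid w" "w \<in> e" using abF by blast
      then have "e \<in> E1 w F" using eF ef by (auto simp: E1_def)
      then show ?thesis using midNF[OF w(1)] w by blast
    next
      case False
      \<comment> \<open>With neither end intermediate, \<open>e\<close> joins the lowest to the
        highest vertex of \<open>F\<close>. A third vertex of \<open>F\<close> is then intermediate
        and takes the charge.\<close>
      have goal: ?thesis if *: "x \<in> ?VF" "y \<in> ?VF" "l \<bullet> x < l \<bullet> y" "e = closed_segment x y" "\<not> ?mid x" "\<not> ?mid y" for x y
      proof -
        have mm: "\<forall>c\<in>?VF. l \<bullet> x \<le> l \<bullet> c \<and> l \<bullet> c \<le> l \<bullet> y" using * by (metis linorder_not_less)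
        then have "e \<in> E2 F" using * by (auto simp: E2_def)
        have "\<not> ?VF \<subseteq> {x,y}"
          using c3 card_mono[of "{x,y}" ?VF] card_insert_le_m1[of 2 "{y}" x] by (auto simp: card_insert_if)
        then obtain w where w: "w \<in> ?VF" "w \<noteq> x" "w \<noteq> y" by blast
        have "l \<bullet> w \<noteq> l \<bullet> x" "l \<bullet> w \<noteq> l \<bullet> y" using l w * by (auto dest: inj_onD)
        then have "?mid w" using mm w * by (metis order_le_less)
        then show ?thesis using midNF[of w] \<open>e \<in> E2 F\<close> by blast
      qed
      have "l \<bullet> a \<noteq> l \<bullet> b" using l ab by (auto dest: inj_onD)
      then consider "l \<bullet> a < l \<bullet> b" | "l \<bullet> b < l \<bullet> a" by linarith
      then show ?thesis
      proof cases
        case 1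
        show ?thesis by (rule goal[OF abF(1,2) 1 ab(4)]) (use False in blast)+
      next
        case 2
        show ?thesis
          by (rule goal[OF abF(2,1) 2 ab(4)[unfolded closed_segment_commute[of a b]]]) (use False in blast)+
      qed
    qed
  qed
  \<comment> \<open>Two edges at \<open>w\<close> and one extreme segment; two faces per vertex then
    make six.\<close>
  have inner: "finite (E1 w F \<union> E2 F) \<and> card (E1 w F \<union> E2 F) \<le> 3" if "w \<in> ?V" "F \<in> NF w" for w F
    using E1[OF that] E2[of F] card_Un_le[of "E1 w F" "E2 F"] by simp
  have mid: "finite (\<Union>F\<in>NF w. E1 w F \<union> E2 F) \<and> card (\<Union>F\<in>NF w. E1 w F \<union> E2 F) \<le> 6" if "w \<in> ?V" for w
  proof -
    have "card (\<Union>F\<in>NF w. E1 w F \<union> E2 F) \<le> (\<Sum>F\<in>NF w. card (E1 w F \<union> E2 F))"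
      using NF[OF that] by (intro card_UN_le) auto
    also have "\<dots> \<le> card (NF w) * 3" using inner[OF that] by (intro sum_bounded_above[where K="3::nat", simplified]) auto
    finally show ?thesis using NF[OF that] inner[OF that] by auto
  qed
  have "card (edges_of Q) \<le> card (\<Union>w\<in>?V. \<Union>F\<in>NF w. E1 w F \<union> E2 F)"
    by (rule card_mono[OF _ cover]) (use fV mid in blast)
  also have "\<dots> \<le> (\<Sum>w\<in>?V. card (\<Union>F\<in>NF w. E1 w F \<union> E2 F))" by (rule card_UN_le[OF fV])
  also have "\<dots> \<le> card ?V * 6" using mid by (intro sum_bounded_above[where K="6::nat", simplified]) auto
  finally show ?thesis by simp
qed

section \<open>Polygonal sets and acyclicity\<close>

definition dirs :: "'a::real_normed_vector set \<Rightarrow> 'a \<Rightarrow> 'a set" where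
  "dirs T x = {u. norm u = 1 \<and> (\<exists>e>0. \<forall>t. 0 < t \<and> t < e \<longrightarrow> x + t *\<^sub>R u \<in> T)}"

text \<open>Only the punctured neighbourhood is described, so \<open>conic_at T x {}\<close> covers
  an isolated point of \<open>T\<close> as well as a point outside a closed
  \<open>T\<close>.\<close>

definition conic_at :: "'a::real_normed_vector set \<Rightarrow> 'a \<Rightarrow> 'a set \<Rightarrow> bool" where
  "conic_at T x U \<longleftrightarrow> finite U \<and> (\<forall>u\<in>U. norm u = 1) \<and>
     (\<exists>e>0. \<forall>y. 0 < dist x y \<and> dist x y < e \<longrightarrow> (y \<in> T \<longleftrightarrow> sgn (y - x) \<in> U))"

lemma sgn_scaleR_unit: "0 < t \<Longrightarrow> norm u = 1 \<Longrightarrow> sgn (t *\<^sub>R u) = u" for u :: "'a::real_normed_vector"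
  by (simp add: sgn_div_norm)

lemma norm_scaleR_sgn: "norm v *\<^sub>R sgn v = v" for v :: "'a::real_normed_vector"
  by (cases "v = 0") (simp_all add: sgn_div_norm)

text \<open>Short rays determine \<open>U\<close>, so below it suffices to exhibit any
  \<open>U\<close> that fits.\<close>

lemma conic_at_imp_dirs:
  fixes T :: "'a::real_normed_vector set"
  assumes "conic_at T x U" shows "dirs T x = U"
proof -
  obtain e where U: "\<And>u. u \<in> U \<Longrightarrow> norm u = 1" and e: "e > 0"
    "\<And>y. 0 < dist x y \<Longrightarrow> dist x y < e \<Longrightarrow> (y \<in> T \<longleftrightarrow> sgn (y - x) \<in> U)"
    using assms by (auto simp: conic_at_def)
  have *: "x + t *\<^sub>R u \<in> T \<longleftrightarrow> u \<in> U" if "0 < t" "t < e" "norm u = 1" for t u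
    using e(2)[of "x + t *\<^sub>R u"] that by (simp add: dist_norm sgn_scaleR_unit)
  show ?thesis
  proof
    show "U \<subseteq> dirs T x" using * U e(1) by (auto simp: dirs_def)
    show "dirs T x \<subseteq> U"
    proof
      fix u assume "u \<in> dirs T x"
      then obtain d where d: "norm u = 1" "d > 0" "\<And>t. 0 < t \<Longrightarrow> t < d \<Longrightarrow> x + t *\<^sub>R u \<in> T"
        by (auto simp: dirs_def)
      define t where "t = min d e / 2"
      have "0 < t" "t < d" "t < e" using d e by (auto simp: t_def)
      then show "u \<in> U" using *[of t u] d by auto
    qed
  qed
qed

lemma conic_at_Un:
  assumes "conic_at S x U" "conic_at T x V" shows "conic_at (S \<union> T) x (U \<union> V)"
proof -
  obtain d where d: "d > 0" "\<And>y. 0 < dist x y \<Longrightarrow> dist x y < d \<Longrightarrow> (y \<in> S \<longleftrightarrow> sgn (y - x) \<in> U)"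
    using assms by (auto simp: conic_at_def)
  obtain e where e: "e > 0" "\<And>y. 0 < dist x y \<Longrightarrow> dist x y < e \<Longrightarrow> (y \<in> T \<longleftrightarrow> sgn (y - x) \<in> V)"
    using assms by (auto simp: conic_at_def)
  have "\<forall>y. 0 < dist x y \<and> dist x y < min d e \<longrightarrow> (y \<in> S \<union> T \<longleftrightarrow> sgn (y - x) \<in> U \<union> V)"
    using d(2) e(2) by auto
  moreover have "min d e > 0" using d e by simp
  ultimately show ?thesis
    using assms unfolding conic_at_def by (intro conjI exI[of _ "min d e"]) auto
qed

lemma conic_at_outside:
  assumes "closed T" "x \<notin> T" shows "conic_at T x {}"
proof -
  have "open (- T)" "x \<in> - T" using assms by auto
  then obtain e where "e > 0" "ball x e \<subseteq> - T" by (meson openE)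
  then show ?thesis unfolding conic_at_def by force
qed

lemma conic_at_segment_end:
  fixes x b :: "'a::real_normed_vector"
  assumes "b \<noteq> x" shows "conic_at (closed_segment x b) x {sgn (b - x)}"
proof -
  have "y \<in> closed_segment x b \<longleftrightarrow> sgn (y - x) = sgn (b - x)" if y: "0 < dist x y" "dist x y < dist x b" for y
  proof
    assume "y \<in> closed_segment x b"
    then obtain s where s: "0 \<le> s" "y = (1 - s) *\<^sub>R x + s *\<^sub>R b" by (auto simp: in_segment)
    then have eq: "y - x = s *\<^sub>R (b - x)" by (simp add: algebra_simps)
    then have "s \<noteq> 0" using y by auto
    then show "sgn (y - x) = sgn (b - x)" using s eq by (simp add: sgn_scaleR)
  next
    assume sg: "sgn (y - x) = sgn (b - x)"
    define s where "s = norm (y - x) / norm (b - x)"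
    have "y - x = norm (y - x) *\<^sub>R sgn (b - x)" using norm_scaleR_sgn[of "y - x"] sg by simp
    also have "\<dots> = s *\<^sub>R (b - x)" by (simp add: s_def sgn_div_norm divide_inverse_commute)
    finally have "y = (1 - s) *\<^sub>R x + s *\<^sub>R b" by (simp add: algebra_simps)
    moreover have "0 \<le> s" "s \<le> 1" using y by (auto simp: s_def dist_norm norm_minus_commute divide_le_eq_1)
    ultimately show "y \<in> closed_segment x b" by (auto simp: in_segment)
  qed
  moreover have "norm (sgn (b - x)) = 1" "dist x b > 0" using assms by (auto simp: norm_sgn)
  ultimately show ?thesis unfolding conic_at_def by (intro conjI exI[of _ "dist x b"]) auto
qed

lemma conic_at_singleton: "conic_at {x} x {}"
  unfolding conic_at_def by (auto intro: exI[of _ 1])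

lemma conic_at_segment: "\<exists>U. conic_at (closed_segment a b) x U" for a b :: "'a::euclidean_space"
proof (cases "x \<in> closed_segment a b")
  case True
  have *: "\<exists>U. conic_at (closed_segment x c) x U" for c
    using conic_at_segment_end[of c x] conic_at_singleton[of x] by (cases "c = x") auto
  have "closed_segment a b = closed_segment x a \<union> closed_segment x b"
    using Un_closed_segment[OF True] by (simp add: closed_segment_commute)
  then show ?thesis using * conic_at_Un by metis
qed (use conic_at_outside closed_segment in blast)

lemma conic_at_polygonal:
  fixes T :: "'a::euclidean_space set"
  assumes "polygonal_set T" shows "conic_at T x (dirs T x)"
proof -
  obtain S where S: "finite S" "\<forall>s\<in>S. \<exists>a b. s = closed_segment a b" "T = \<Union>S"
    using assms by (auto simp: polygonal_set_def)
  have "\<exists>U. conic_at (\<Union>S) x U"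
    using S(1,2)
  proof (induction S)
    case empty
    then show ?case using conic_at_outside[of "{}" x] by auto
  next
    case (insert s S)
    then show ?case using conic_at_segment conic_at_Un by (metis Union_insert insertCI)
  qed
  then show ?thesis using S(3) conic_at_imp_dirs by metis
qed

lemma compact_polygonal: "polygonal_set T \<Longrightarrow> compact T"
  unfolding polygonal_set_def by (auto intro!: compact_Union)

text \<open>Bends count as irregular although their degree is two; this makes the connections
  between neighbouring irregular points straight.\<close>

definition irregular :: "'a::real_normed_vector set \<Rightarrow> 'a set" where
  "irregular T = {x \<in> T. \<nexists>u. dirs T x = {u, -u}}"

text \<open>Away from its apex, a cone of finitely many rays is locally a straight line: the other
  directions are isolated from that of \<open>y\<close>.\<close>

lemma conic_at_radial:
  fixes T :: "'a::real_normed_vector set"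
  assumes T: "finite U" "\<And>z. 0 < dist x z \<Longrightarrow> dist x z < e \<Longrightarrow> (z \<in> T \<longleftrightarrow> sgn (z - x) \<in> U)"
    and y: "y \<in> T" "0 < dist x y" "dist x y < e"
  shows "conic_at T y {sgn (y - x), - sgn (y - x)}"
proof -
  define u where "u = sgn (y - x)"
  define r where "r = norm (y - x)"
  have r: "0 < r" using y by (auto simp: r_def)
  have nu: "norm u = 1" using y by (auto simp: u_def norm_sgn)
  have yx: "y = x + r *\<^sub>R u" by (simp add: r_def u_def norm_scaleR_sgn)
  have uU: "u \<in> U" using T(2)[of y] y by (simp add: u_def)
  have cont: "isCont (\<lambda>z. sgn (z - x)) y"
    using r by (intro isCont_sgn continuous_intros) (auto simp: r_def)
  have "open (- (U - {u}))" "u \<in> - (U - {u})"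
    using finite_imp_closed[of "U - {u}"] T(1) by (auto simp only: open_Compl finite_Diff)
  then have "\<forall>\<^sub>F z in at y. sgn (z - x) \<in> - (U - {u})"
    by (rule topological_tendstoD[OF cont[unfolded isCont_def u_def[symmetric]]])
  then obtain d where d: "d > 0" "\<And>z. z \<noteq> y \<Longrightarrow> dist z y < d \<Longrightarrow> sgn (z - x) \<notin> U - {u}"
    by (auto simp: eventually_at)
  \<comment> \<open>\<open>m \<le> d\<close> excludes the other rays, \<open>m \<le> r\<close> keeps
    \<open>z\<close> from passing the apex \<open>x\<close>, and \<open>m \<le> e - r\<close> keeps
    it where \<open>T\<close> is conic about \<open>x\<close>.\<close>
  define m where "m = min d (min r (e - r))"
  have m: "0 < m" "m \<le> d" "m \<le> r" "m \<le> e - r"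
    using d r y by (auto simp: m_def r_def dist_norm norm_minus_commute)
  have "z \<in> T \<longleftrightarrow> sgn (z - y) \<in> {u, -u}" if z: "0 < dist y z" "dist y z < m" for z
  proof -
    have "dist x z > 0" "dist x z < e"
      using z m dist_triangle[of x z y] dist_triangle[of x y z] unfolding r_def dist_norm
      by (auto simp: norm_minus_commute dist_norm)
    then have "z \<in> T \<longleftrightarrow> sgn (z - x) \<in> U" using T(2) by blast
    also have "\<dots> \<longleftrightarrow> sgn (z - x) = u" using d(2)[of z] uU z m by (auto simp: dist_commute)
    also have "\<dots> \<longleftrightarrow> sgn (z - y) \<in> {u, -u}"
    proof
      assume "sgn (z - x) = u"
      then have "z - x = norm (z - x) *\<^sub>R u" using norm_scaleR_sgn[of "z - x"] by simp
      then have zy: "z - y = (norm (z - x) - r) *\<^sub>R u" by (simp add: yx algebra_simps)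
      then have "norm (z - x) - r \<noteq> 0" using z by auto
      then show "sgn (z - y) \<in> {u, -u}"
        unfolding zy sgn_scaleR using sgn_scaleR_unit[of 1 u] nu by (auto simp: sgn_real_def)
    next
      assume "sgn (z - y) \<in> {u, -u}"
      then have "z - y = norm (z - y) *\<^sub>R u \<or> z - y = (- norm (z - y)) *\<^sub>R u"
        using norm_scaleR_sgn[of "z - y"] by (metis insertE empty_iff scaleR_minus_left scaleR_minus_right)
      moreover have "norm (z - y) < m" using z by (simp add: dist_norm norm_minus_commute)
      ultimately have "\<exists>s. z - y = s *\<^sub>R u \<and> \<bar>s\<bar> < m"
        by (elim disjE) (rule exI, erule conjI, simp)+
      then obtain s where s: "z - y = s *\<^sub>R u" "\<bar>s\<bar> < m" by blast
      have "z - x = (z - y) + (y - x)" by simp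
      also have "\<dots> = (r + s) *\<^sub>R u" using s by (simp add: yx algebra_simps)
      finally have "z - x = (r + s) *\<^sub>R u" .
      moreover have "r + s > 0" using s m by linarith
      ultimately show "sgn (z - x) = u" using sgn_scaleR_unit nu by metis
    qed
    finally show ?thesis .
  qed
  then show ?thesis
    unfolding conic_at_def u_def[symmetric] using m(1) nu by (auto intro!: exI[of _ m])
qed

locale polygonal =
  fixes T :: "'a::euclidean_space set"
  assumes polygonal: "polygonal_set T"
begin

lemma conic: obtains e where "e > 0" "\<And>y. 0 < dist x y \<Longrightarrow> dist x y < e \<Longrightarrow> (y \<in> T \<longleftrightarrow> sgn (y - x) \<in> dirs T x)"
  using conic_at_polygonal[OF polygonal, of x] by (auto simp: conic_at_def)

lemma finite_dirs: "finite (dirs T x)"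
  using conic_at_polygonal[OF polygonal, of x] by (auto simp: conic_at_def)

lemma compact: "compact T" by (rule compact_polygonal[OF polygonal])

lemma irregular_isolated: obtains e where "e > 0" "\<And>y. 0 < dist x y \<Longrightarrow> dist x y < e \<Longrightarrow> y \<notin> irregular T"
proof -
  obtain e where e: "e > 0" "\<And>y. 0 < dist x y \<Longrightarrow> dist x y < e \<Longrightarrow> (y \<in> T \<longleftrightarrow> sgn (y - x) \<in> dirs T x)"
    using conic by blast
  have "y \<notin> irregular T" if "0 < dist x y" "dist x y < e" for y
  proof
    assume y: "y \<in> irregular T"
    then have "y \<in> T" by (simp add: irregular_def)
    have "conic_at T y {sgn (y - x), - sgn (y - x)}"
      by (rule conic_at_radial[OF finite_dirs e(2)]) (use that \<open>y \<in> T\<close> in auto)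
    from conic_at_imp_dirs[OF this] show False using y by (auto simp: irregular_def)
  qed
  then show ?thesis using that e(1) by blast
qed

text \<open>By compactness infinitely many irregular points would accumulate somewhere, but they are
  isolated around every point.\<close>

lemma finite_irregular: "finite (irregular T)"
proof (rule ccontr)
  assume "infinite (irregular T)"
  moreover have "irregular T \<subseteq> T" by (auto simp: irregular_def)
  ultimately obtain x where "x islimpt irregular T"
    using compact unfolding compact_eq_Bolzano_Weierstrass by blast
  moreover obtain e where "e > 0" "\<And>y. 0 < dist x y \<Longrightarrow> dist x y < e \<Longrightarrow> y \<notin> irregular T"
    using irregular_isolated by blast
  ultimately show False by (metis dist_commute dist_pos_lt islimpt_approachable)
qed

section \<open>The graph of irregular points\<close>

definition adj :: "'a \<Rightarrow> 'a \<Rightarrow> bool" where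
  "adj x y \<longleftrightarrow> x \<in> irregular T \<and> y \<in> irregular T \<and> x \<noteq> y \<and> closed_segment x y \<subseteq> T
     \<and> open_segment x y \<inter> irregular T = {}"

lemma adj_sym: "adj x y \<Longrightarrow> adj y x"
  by (auto simp: adj_def closed_segment_commute open_segment_commute)

text \<open>The ray in direction \<open>u\<close> is followed through regular points up to the
  supremum \<open>r\<close>. Its end is in \<open>T\<close> by closedness and cannot be regular,
  since \<open>T\<close> would then pass straight through and the stretch could be extended.\<close>

lemma ex_adj_in_direction:
  assumes x: "x \<in> irregular T" and u: "u \<in> dirs T x"
  obtains y where "adj x y" "sgn (y - x) = u"
proof -
  let ?W = "irregular T"
  have nu: "norm u = 1" using u by (simp add: dirs_def)
  define A where "A = {t. 0 < t \<and> (\<forall>s. 0 < s \<and> s \<le> t \<longrightarrow> x + s *\<^sub>R u \<in> T - ?W)}"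
  have start: "\<exists>t>0. \<forall>s. 0 < s \<and> s \<le> t \<longrightarrow> z + s *\<^sub>R u \<in> T - ?W" if z: "u \<in> dirs T z" for z
  proof -
    obtain d where d: "d > 0" "\<And>t. 0 < t \<Longrightarrow> t < d \<Longrightarrow> z + t *\<^sub>R u \<in> T"
      using z by (auto simp: dirs_def)
    obtain e where e: "e > 0" "\<And>y. 0 < dist z y \<Longrightarrow> dist z y < e \<Longrightarrow> y \<notin> ?W"
      using irregular_isolated by blast
    have "z + s *\<^sub>R u \<in> T - ?W" if "0 < s" "s \<le> min d e / 2" for s
      using that d(1) e(1) d(2)[of s] e(2)[of "z + s *\<^sub>R u"] nu by (auto simp: dist_norm)
    then show ?thesis using d(1) e(1) by (intro exI[of _ "min d e / 2"]) auto
  qed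
  have Ane: "A \<noteq> {}" using start[OF u] by (auto simp: A_def)
  obtain B where B: "\<And>y. y \<in> T \<Longrightarrow> norm y \<le> B" using compact_imp_bounded[OF compact] by (auto simp: bounded_iff)
  have bdd: "bdd_above A"
  proof (rule bdd_aboveI[of _ "B + norm x"])
    fix t assume t: "t \<in> A"
    then have "norm (x + t *\<^sub>R u) \<le> B" by (intro B) (auto simp: A_def)
    moreover have "norm (t *\<^sub>R u) \<le> norm (x + t *\<^sub>R u) + norm x"
      by (metis add_diff_cancel_left' norm_triangle_ineq4)
    ultimately show "t \<le> B + norm x" using t nu by (auto simp: A_def)
  qed
  define r where "r = Sup A"
  have r0: "0 < r"
  proof -
    obtain t where t: "t \<in> A" using Ane by blast
    then have "0 < t" by (simp add: A_def)
    also have "t \<le> r" unfolding r_def using t bdd by (rule cSup_upper)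
    finally show ?thesis .
  qed
  have below: "x + s *\<^sub>R u \<in> T - ?W" if s: "0 < s" "s < r" for s
  proof -
    obtain t where "t \<in> A" "s < t" using s(2) less_cSup_iff[OF Ane bdd] by (auto simp: r_def)
    then show ?thesis using s by (auto simp: A_def)
  qed
  define y where "y = x + r *\<^sub>R u"
  have yT: "y \<in> T"
  proof -
    have "((\<lambda>s. x + s *\<^sub>R u) \<longlongrightarrow> y) (at_left r)" unfolding y_def by (intro tendsto_intros)
    moreover have "\<forall>\<^sub>F s in at_left r. x + s *\<^sub>R u \<in> T"
      using eventually_at_left_real[OF r0] by eventually_elim (use below in auto)
    ultimately show ?thesis
      by (rule Lim_in_closed_set[OF compact_imp_closed[OF compact], rotated 2]) simp_all
  qed
  have yW: "y \<in> ?W"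
  proof (rule ccontr)
    assume yW: "y \<notin> ?W"
    then obtain v where v: "dirs T y = {v, -v}" using yT by (auto simp: irregular_def)
    \<comment> \<open>\<open>T\<close> reaches \<open>y\<close> from behind, so the straight germ at
      \<open>y\<close> has axis \<open>u\<close> and also continues forward.\<close>
    have "-u \<in> dirs T y"
    proof -
      have "y + t *\<^sub>R (-u) \<in> T" if "0 < t" "t < r" for t
        using below[of "r - t"] that by (simp add: y_def algebra_simps)
      then show ?thesis using nu r0 by (auto simp: dirs_def)
    qed
    then have "u \<in> dirs T y" unfolding v by (metis empty_iff insert_iff minus_minus)
    from start[OF this]
    obtain t where t: "t > 0" "\<forall>s. 0 < s \<and> s \<le> t \<longrightarrow> y + s *\<^sub>R u \<in> T - ?W" by auto
    have "x + s *\<^sub>R u \<in> T - ?W" if s: "0 < s" "s \<le> r + t" for s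
    proof -
      consider "s < r" | "s = r" | "s > r" by linarith
      then show ?thesis
      proof cases
        case 3
        then show ?thesis using t(2)[rule_format, of "s - r"] s by (simp add: y_def algebra_simps)
      qed (use below s yT yW y_def in auto)
    qed
    then have "r + t \<in> A" using r0 t by (auto simp: A_def)
    then have "r + t \<le> r" unfolding r_def using bdd by (rule cSup_upper)
    then show False using t by simp
  qed
  have pt: "\<exists>s. 0 \<le> s \<and> s \<le> r \<and> p = x + s *\<^sub>R u" if pxy: "p \<in> closed_segment x y" for p
  proof -
    obtain c where c: "0 \<le> c" "c \<le> 1" "p = (1 - c) *\<^sub>R x + c *\<^sub>R y" using pxy by (auto simp: in_segment)
    then have "p = x + (c * r) *\<^sub>R u" by (simp add: y_def algebra_simps)
    moreover have "0 \<le> c * r" "c * r \<le> r" using c r0 by (auto simp: mult_left_le_one_le)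
    ultimately show ?thesis by blast
  qed
  have "closed_segment x y \<subseteq> T"
  proof
    fix p assume "p \<in> closed_segment x y"
    from pt[OF this] obtain s where s: "0 \<le> s" "s \<le> r" "p = x + s *\<^sub>R u" by auto
    consider "s = 0" | "s = r" | "0 < s" "s < r" using s by linarith
    then show "p \<in> T"
      by cases (use s below[of s] yT x in \<open>auto simp: y_def irregular_def\<close>)
  qed
  moreover have "open_segment x y \<inter> ?W = {}"
  proof (rule ccontr)
    assume "open_segment x y \<inter> ?W \<noteq> {}"
    then obtain p where p: "p \<in> closed_segment x y" "p \<noteq> x" "p \<noteq> y" "p \<in> ?W"
      by (auto simp: open_segment_def)
    from pt[OF p(1)] obtain s where s: "0 \<le> s" "s \<le> r" "p = x + s *\<^sub>R u" by auto
    then have "s \<noteq> 0" "s \<noteq> r" using p(2,3) by (auto simp: y_def)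
    then have "0 < s" "s < r" using s by simp_all
    then show False using below s p by auto
  qed
  moreover have "y \<noteq> x" "sgn (y - x) = u" using r0 nu by (auto simp: y_def sgn_scaleR_unit)
  ultimately show ?thesis using that[of y] x yW by (auto simp: adj_def)
qed

text \<open>The neighbour found in a direction determines that direction, so different directions
  have different neighbours.\<close>

lemma card_dirs_le_degree:
  assumes x: "x \<in> irregular T"
  shows "card (dirs T x) \<le> card {y \<in> irregular T. adj x y}"
proof -
  have "\<forall>u\<in>dirs T x. \<exists>y. adj x y \<and> sgn (y - x) = u" using ex_adj_in_direction[OF x] by metis
  then obtain f where f: "\<And>u. u \<in> dirs T x \<Longrightarrow> adj x (f u) \<and> sgn (f u - x) = u" by metis
  have "inj_on f (dirs T x)" by (rule inj_on_inverseI[of _ "\<lambda>y. sgn (y - x)"]) (use f in blast)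
  moreover have "f ` dirs T x \<subseteq> {y \<in> irregular T. adj x y}" using f by (auto simp: adj_def)
  ultimately show ?thesis using finite_irregular by (intro card_inj_on_le) auto
qed

lemma between_on_line:
  fixes p v :: 'a
  assumes "0 < s" "s < s'" "0 < t'"
  shows "p + s *\<^sub>R v \<in> closed_segment (p + s' *\<^sub>R v) (p - t' *\<^sub>R v)"
proof -
  define c where "c = (s' - s) / (s' + t')"
  have "0 \<le> c" "c \<le> 1" using assms by (auto simp: c_def field_simps)
  moreover have "c * (s' + t') = s' - s" using assms by (simp add: c_def)
  then have "(1 - c) * s' - c * t' = s" by (simp add: algebra_simps)
  moreover have "(1 - c) *\<^sub>R (p + s' *\<^sub>R v) + c *\<^sub>R (p - t' *\<^sub>R v) = p + ((1 - c) * s' - c * t') *\<^sub>R v"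
    by (simp add: algebra_simps)
  ultimately show ?thesis by (auto simp: in_segment)
qed

lemma open_segment_direction:
  fixes p a b :: 'a
  assumes "p \<in> open_segment a b"
  obtains v s t where "norm v = 1" "0 < s" "0 < t" "a = p + s *\<^sub>R v" "b = p - t *\<^sub>R v" 
proof -
  obtain c where c: "0 < c" "c < 1" "p = (1 - c) *\<^sub>R a + c *\<^sub>R b" and ab: "a \<noteq> b"
    using assms by (auto simp: in_segment)
  define v where "v = sgn (a - b)"
  define n where "n = norm (a - b)"
  have e: "a - b = n *\<^sub>R v" by (simp add: n_def v_def norm_scaleR_sgn)
  have "a = p + c *\<^sub>R (a - b)" "b = p - (1 - c) *\<^sub>R (a - b)" using c(3) by (simp_all add: algebra_simps)
  note eqs = this[unfolded e scaleR_scaleR]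
  have n: "n > 0" "norm v = 1" using ab by (auto simp: n_def v_def norm_sgn)
  then have "0 < c * n" "0 < (1 - c) * n" using c(1,2) by simp_all
  then show ?thesis by (rule that[OF n(2) _ _ eqs])
qed

text \<open>A common point that is regular is inside both segments, and both follow the one line of
  \<open>T\<close> there. Their ends are the first irregular points on either side, so the segments
  coincide, against \<open>ne\<close>.\<close>

lemma adj_segments_cross:
  assumes xy: "adj x y" and ab: "adj a b" and ne: "{x,y} \<noteq> {a,b}"
  shows "closed_segment x y \<inter> closed_segment a b \<subseteq> {x,y} \<inter> {a,b}"
proof
  fix p assume p: "p \<in> closed_segment x y \<inter> closed_segment a b"
  show "p \<in> {x,y} \<inter> {a,b}"
  proof (cases "p \<in> irregular T")
    case True
    then have "p \<notin> open_segment x y" "p \<notin> open_segment a b" using xy ab unfolding adj_def by blast+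
    then show ?thesis using p by (simp add: open_segment_def)
  next
    case False
    have "p \<notin> {x,y}" "p \<notin> {a,b}" using False xy ab unfolding adj_def by blast+
    then have po: "p \<in> open_segment x y" "p \<in> open_segment a b" using p by (simp_all add: open_segment_def)
    obtain v s t where v: "norm v = 1" "0 < s" "0 < t" "x = p + s *\<^sub>R v" "y = p - t *\<^sub>R v"
      using open_segment_direction[OF po(1)] .
    have pT: "p \<in> T" using p xy by (auto simp: adj_def)
    then obtain w where w: "dirs T p = {w, -w}" using False by (auto simp: irregular_def)
    have dir: "v' \<in> dirs T p" if "norm v' = 1" "0 < s'" "closed_segment p (p + s' *\<^sub>R v') \<subseteq> T" for v' s'
    proof -
      have "p + r *\<^sub>R v' \<in> T" if "0 < r" "r < s'" for r
      proof -
        have "p + r *\<^sub>R v' = (1 - r / s') *\<^sub>R p + (r / s') *\<^sub>R (p + s' *\<^sub>R v')"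
          using that by (simp add: algebra_simps)
        then have "p + r *\<^sub>R v' \<in> closed_segment p (p + s' *\<^sub>R v')"
          using that unfolding in_segment by (intro exI[of _ "r/s'"]) auto
        then show ?thesis using \<open>closed_segment p (p + s' *\<^sub>R v') \<subseteq> T\<close> by blast
      qed
      then show ?thesis using that by (auto simp: dirs_def)
    qed
    have subs: "closed_segment p c \<subseteq> T" if "c \<in> {x,y,a,b}" for c
    proof -
      have "closed_segment p c \<subseteq> closed_segment x y \<or> closed_segment p c \<subseteq> closed_segment a b"
        using that p by (auto simp: subset_closed_segment)
      then show ?thesis using xy ab by (auto simp: adj_def)
    qed
    have vw: "v \<in> {w,-w}" using dir[of v s] v subs[of x] w by simp
    \<comment> \<open>Of two different ends on the same side, the nearer one would be an irregular
      point inside the other segment. This treats one orientation; the other is obtained by swapping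
      \<open>a\<close> and \<open>b\<close>.\<close>
    have main: "x = a' \<and> y = b'" if ab': "adj a' b'" "a' = p + s' *\<^sub>R v" "b' = p - t' *\<^sub>R v" "0 < s'" "0 < t'" for a' b' s' t'
    proof
      have no: "False" if "c \<in> closed_segment c1 c2" "c \<noteq> c1" "c \<noteq> c2" "c \<in> irregular T" "adj c1 c2" for c c1 c2
        using that by (auto simp: adj_def open_segment_def)
      have W: "x \<in> irregular T" "y \<in> irregular T" "a' \<in> irregular T" "b' \<in> irregular T"
        using xy ab' by (auto simp: adj_def)
      have nev: "p + c *\<^sub>R v = p + d *\<^sub>R v \<longleftrightarrow> c = d" for c d using v by auto
      have nev2: "p + c *\<^sub>R v = p - d *\<^sub>R v \<longleftrightarrow> c = - d" for c d
        using nev[of c "-d"] by simp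
      have nev3: "p - c *\<^sub>R v = p - d *\<^sub>R v \<longleftrightarrow> c = d" for c d using v by auto
      have nev4: "p - c *\<^sub>R v = p + d *\<^sub>R v \<longleftrightarrow> c = -d" for c d
        using nev[of "-c" d] by auto
      note nevs = nev nev2 nev3 nev4
      have v0: "v \<noteq> 0" using v by auto
      show "x = a'"
      proof (rule ccontr)
        assume "x \<noteq> a'"
        then have "s \<noteq> s'" using v(4) ab'(2) by auto
        then consider "s < s'" | "s' < s" by linarith
        then show False
        proof cases
          case 1
          have "x \<noteq> a'" "x \<noteq> b'" using v ab' v0 1 by (auto simp: nevs)
          then show False using no[of x a' b'] between_on_line[OF v(2) 1 ab'(5), of p v] v(4) ab'(1-3) W by metis
        next
          case 2
          have "a' \<noteq> x" "a' \<noteq> y" using v ab' v0 2 by (auto simp: nevs)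
          then show False using no[of a' x y] between_on_line[OF ab'(4) 2 v(3), of p v] v(4,5) ab'(2) W xy by metis
        qed
      qed
      show "y = b'"
      proof (rule ccontr)
        assume "y \<noteq> b'"
        then have "t \<noteq> t'" using v(5) ab'(3) by auto
        then consider "t < t'" | "t' < t" by linarith
        then show False
        proof cases
          case 1
          have "y \<noteq> b'" "y \<noteq> a'" using v ab' v0 1 by (auto simp: nevs)
          moreover have "y \<in> closed_segment b' a'"
            using between_on_line[OF v(3) 1 ab'(4), of p "-v"] v(5) ab'(2,3) by simp
          ultimately show False using no W adj_sym[OF ab'(1)] by blast
        next
          case 2
          have "b' \<noteq> y" "b' \<noteq> x" using v ab' v0 2 by (auto simp: nevs)
          moreover have "b' \<in> closed_segment y x"
            using between_on_line[OF ab'(5) 2 v(2), of p "-v"] v(4,5) ab'(3) by simp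
          ultimately show False using no W adj_sym[OF xy] by blast
        qed
      qed
    qed
    obtain v' s' t' where v': "norm v' = 1" "0 < s'" "0 < t'" "a = p + s' *\<^sub>R v'" "b = p - t' *\<^sub>R v'"
      using open_segment_direction[OF po(2)] .
    have "v' \<in> {w,-w}" using dir[of v' s'] v' subs[of a] w by simp
    then consider "v' = v" | "v' = - v" using vw by auto
    then show ?thesis
    proof cases
      case 1
      have "x = a \<and> y = b" by (rule main[OF ab v'(4,5)[unfolded 1] v'(2,3)])
      then show ?thesis using ne by blast
    next
      case 2
      have "b = p + t' *\<^sub>R v" "a = p - s' *\<^sub>R v" using v'(4,5) 2 by simp_all
      then have "x = b \<and> y = a" by (rule main[OF adj_sym[OF ab] _ _ v'(3,2)])
      then show ?thesis using ne by blast
    qed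
  qed
qed

end

section \<open>Degrees and cycles in finite graphs\<close>

text \<open>Deleting a vertex of degree at most one lowers the degree sum by at most two and the
  bound by exactly two, so the inequality persists. It fails for a single vertex, as
  \<open>E\<close> is irreflexive, so the deletion stops before the graph is empty.\<close>

lemma min_degree_subgraph:
  assumes "finite V" "V \<noteq> {}" "symp E" "irreflp E"
    and "2 * card V \<le> (\<Sum>v\<in>V. card {w \<in> V. E v w})"
  shows "\<exists>W\<subseteq>V. W \<noteq> {} \<and> (\<forall>v\<in>W. 2 \<le> card {w \<in> W. E v w})"
  using assms(1,2,5)
proof (induction V rule: finite_psubset_induct)
  case (psubset V)
  show ?case
  proof (cases "\<forall>v\<in>V. 2 \<le> card {w \<in> V. E v w}")
    case False
    then obtain v where v: "v \<in> V" "card {w \<in> V. E v w} \<le> 1" by force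
    let ?V = "V - {v}"
    have fin: "finite ?V" using psubset by simp
    have nv: "{w \<in> V. E v w} = {w \<in> ?V. E v w}" using assms(4) by (auto simp: irreflp_def)
    have "card {u \<in> V. E w u} = card {u \<in> ?V. E w u} + (if E v w then 1 else 0)" if "w \<in> ?V" for w
    proof (cases "E v w")
      case True
      then have "E w v" using assms(3) by (auto dest: sympD)
      then have "{u \<in> V. E w u} = insert v {u \<in> ?V. E w u}" using v by auto
      then show ?thesis using True fin by simp
    next
      case False
      then have "\<not> E w v" using assms(3) by (auto dest: sympD)
      then have "{u \<in> V. E w u} = {u \<in> ?V. E w u}" by auto
      then show ?thesis using False by simp
    qed
    then have "(\<Sum>w\<in>?V. card {u \<in> V. E w u}) = (\<Sum>w\<in>?V. card {u \<in> ?V. E w u}) + (\<Sum>w\<in>?V. if E v w then 1 else 0)"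
      by (simp add: sum.distrib)
    also have "(\<Sum>w\<in>?V. if E v w then 1 else 0) = card {w \<in> ?V. E v w}"
      using fin by (simp add: sum.If_cases Int_def)
    finally have "(\<Sum>w\<in>V. card {u \<in> V. E w u}) = (\<Sum>w\<in>?V. card {u \<in> ?V. E w u}) + 2 * card {w \<in> V. E v w}"
      using sum.remove[OF psubset(1) v(1), of "\<lambda>w. card {u \<in> V. E w u}"] nv by simp
    moreover have "card V = Suc (card ?V)" by (rule card.remove[OF psubset(1) v(1)])
    ultimately have le: "2 * card ?V \<le> (\<Sum>w\<in>?V. card {u \<in> ?V. E w u})"
      using psubset.prems(2) v(2) by linarith
    show ?thesis
    proof (cases "?V = {}")
      case True
      then have "V = {v}" using v by auto
      then show ?thesis using psubset.prems(2) assms(4) by (auto simp: irreflp_def)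
    next
      case False
      have "?V \<subset> V" using v by auto
      from psubset.IH[OF this False le] show ?thesis by blast
    qed
  qed (use psubset.prems in blast)
qed

text \<open>The first vertex of a longest path has all its neighbours on the path. One of them is
  not its successor and closes a cycle; \<open>2 \<le> length xs\<close> excludes running along one
  edge and back.\<close>

lemma ex_cycle:
  assumes W: "finite W" "W \<noteq> {}" and E: "symp E" "irreflp E"
    and deg: "\<forall>v\<in>W. 2 \<le> card {w \<in> W. E v w}"
  obtains v xs where "distinct (v # xs)" "2 \<le> length xs" "successively E (v # xs)" "E (last xs) v"
proof -
  define P where "P xs \<longleftrightarrow> xs \<noteq> [] \<and> distinct xs \<and> set xs \<subseteq> W \<and> successively E xs" for xs
  obtain w where "w \<in> W" using W by auto
  then have Pw: "P [w]" by (auto simp: P_def)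
  have "\<forall>xs. P xs \<longrightarrow> length xs < Suc (card W)"
  proof (intro allI impI)
    fix xs assume "P xs"
    then have "distinct xs" "set xs \<subseteq> W" by (simp_all add: P_def)
    then have "length xs \<le> card W" using card_mono[OF W(1)] distinct_card[of xs] by metis
    then show "length xs < Suc (card W)" by simp
  qed
  from ex_has_greatest_nat[of P, OF Pw this]
  obtain xs where xs: "P xs" "\<And>ys. P ys \<Longrightarrow> length ys \<le> length xs" by blast
  obtain v ys where vys: "xs = v # ys" using xs(1) by (cases xs) (auto simp: P_def)
  have vW: "v \<in> W" using xs(1) vys by (auto simp: P_def)
  have inc: "w \<in> set ys" if w: "w \<in> W" "E v w" for w
  proof (rule ccontr)
    assume "w \<notin> set ys"
    moreover have "w \<noteq> v" using w E(2) by (auto simp: irreflp_def)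
    ultimately have "P (w # xs)"
      using xs(1) w vys E(1) by (auto simp: P_def successively_Cons dest: sympD)
    then show False using xs(2)[of "w # xs"] by simp
  qed
  have d2: "2 \<le> card {w \<in> W. E v w}" using deg vW by blast
  have "\<not> {w \<in> W. E v w} \<subseteq> {hd ys}"
    using d2 card_mono[of "{hd ys}" "{w \<in> W. E v w}"] by auto
  then obtain w where w: "w \<in> W" "E v w" "w \<noteq> hd ys" by auto
  obtain as bs where ab: "ys = as @ w # bs" using inc[OF w(1,2)] by (auto simp: in_set_conv_decomp)
  have "as \<noteq> []" using ab w(3) by auto
  show ?thesis
  proof (rule that[of v "as @ [w]"])
    show "distinct (v # as @ [w])" using xs(1) vys ab by (auto simp: P_def)
    show "2 \<le> length (as @ [w])" using \<open>as \<noteq> []\<close> by (cases as) auto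
    have "successively E ((v # as @ [w]) @ bs)" using xs(1) vys ab by (simp add: P_def)
    then show "successively E (v # as @ [w])" using successively_append_iff by blast
    show "E (last (as @ [w])) v" using w(2) E(1) by (auto dest: sympD)
  qed
qed

section \<open>Topological degree as a number of directions\<close>

text \<open>On the spokes \<open>sgn (y - x)\<close> is continuous with finitely many values, hence
  constant on connected subsets, so the components are the spokes.\<close>

lemma components_cone:
  fixes x :: "'a::real_normed_vector"
  assumes U: "finite U" "\<And>u. u \<in> U \<Longrightarrow> norm u = 1" and r: "0 < r"
  shows "card (components (\<Union>u\<in>U. (\<lambda>t. x + t *\<^sub>R u) ` {0<..<r})) = card U"
proof -
  define R where "R u = (\<lambda>t. x + t *\<^sub>R u) ` {0<..<r}" for u
  let ?S = "\<Union>u\<in>U. R u"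
  have sg: "sgn (y - x) = u" if "y \<in> R u" "u \<in> U" for y u
    using that U(2) by (auto simp: R_def sgn_scaleR_unit)
  have conR: "connected (R u)" for u
    unfolding R_def by (intro connected_continuous_image continuous_intros) simp
  have neR: "R u \<noteq> {}" for u using r by (auto simp: R_def)
  have sub: "\<exists>u\<in>U. d \<subseteq> R u" if d: "connected d" "d \<subseteq> ?S" "d \<noteq> {}" for d
  proof -
    have xd: "x \<notin> d" using d(2) U(2) by (force simp: R_def)
    have "connected ((\<lambda>y. sgn (y - x)) ` d)"
      by (intro connected_continuous_image d(1) continuous_intros) (use xd in auto)
    moreover have subU: "(\<lambda>y. sgn (y - x)) ` d \<subseteq> U" using d(2) sg by fastforce
    then have "finite ((\<lambda>y. sgn (y - x)) ` d)" using U(1) finite_subset by blast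
    ultimately obtain u where u: "(\<lambda>y. sgn (y - x)) ` d = {u}"
      using connected_finite_iff_sing d(3) by (metis image_is_empty)
    have "d \<subseteq> R u"
    proof
      fix y assume y: "y \<in> d"
      then obtain u' where "u' \<in> U" "y \<in> R u'" using d(2) by blast
      moreover have "sgn (y - x) = u" using u y by blast
      ultimately show "y \<in> R u" using sg by blast
    qed
    then show ?thesis using u subU by blast
  qed
  have dis: "u = v" if "u \<in> U" "v \<in> U" "R u \<subseteq> R v" for u v
    using that neR[of u] sg by (metis ex_in_conv subsetD)
  have "components ?S = R ` U"
  proof
    show "R ` U \<subseteq> components ?S"
    proof
      fix c assume "c \<in> R ` U"
      then obtain u where u: "u \<in> U" "c = R u" by blast
      have "d = c" if d: "c \<subseteq> d" "d \<subseteq> ?S" "connected d" for d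
      proof -
        have "d \<noteq> {}" using d(1) u neR by auto
        then obtain v where "v \<in> U" "d \<subseteq> R v" using sub d by blast
        then show ?thesis using dis[of u v] d(1) u by blast
      qed
      then show "c \<in> components ?S"
        unfolding in_components_maximal
      proof (intro conjI allI impI)
        show "c \<noteq> {}" "connected c" using u neR conR by simp_all
        show "c \<subseteq> ?S" using u by blast
      qed simp
    qed
    show "components ?S \<subseteq> R ` U"
    proof
      fix c assume c: "c \<in> components ?S"
      from sub[OF in_components_connected[OF c] in_components_subset[OF c] in_components_nonempty[OF c]]
      obtain u where u: "u \<in> U" "c \<subseteq> R u" by auto
      moreover have "R u \<subseteq> ?S" using u by blast
      ultimately have "R u = c" using c conR[of u] neR[of u] unfolding in_components_maximal by simp
      then show "c \<in> R ` U" using u by blast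
    qed
  qed
  moreover have "inj_on R U" using dis by (intro inj_onI) auto
  ultimately show ?thesis unfolding R_def by (simp add: card_image)
qed

text \<open>For all small radii the punctured piece of \<open>T\<close> is a bunch of open spokes.
  The \<open>THE\<close> in \<open>tdeg\<close> is well defined because two candidates can be
  compared at a common small radius.\<close>

lemma tdeg_eq_card_dirs:
  assumes "polygonal_set T" shows "tdeg T x = card (dirs T x)"
proof -
  interpret polygonal T by unfold_locales (rule assms)
  obtain e where e: "e > 0" "\<And>y. 0 < dist x y \<Longrightarrow> dist x y < e \<Longrightarrow> (y \<in> T \<longleftrightarrow> sgn (y - x) \<in> dirs T x)"
    using conic by blast
  have nu: "norm u = 1" if "u \<in> dirs T x" for u using that by (simp add: dirs_def)
  have *: "card (components ((T \<inter> ball x r) - {x})) = card (dirs T x)" if r: "0 < r" "r < e" for r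
  proof -
    have "(T \<inter> ball x r) - {x} = (\<Union>u\<in>dirs T x. (\<lambda>t. x + t *\<^sub>R u) ` {0<..<r})" (is "_ = ?R")
    proof
      show "(T \<inter> ball x r) - {x} \<subseteq> ?R"
      proof
        fix y assume y: "y \<in> (T \<inter> ball x r) - {x}"
        then have "sgn (y - x) \<in> dirs T x" using e(2)[of y] r by auto
        moreover have "y = x + norm (y - x) *\<^sub>R sgn (y - x)" by (simp add: norm_scaleR_sgn)
        moreover have "norm (y - x) \<in> {0<..<r}" using y by (auto simp: dist_norm norm_minus_commute)
        ultimately show "y \<in> ?R" by blast
      qed
      show "?R \<subseteq> (T \<inter> ball x r) - {x}"
      proof
        fix y assume "y \<in> ?R"
        then obtain u t where "u \<in> dirs T x" "0 < t" "t < r" "y = x + t *\<^sub>R u" by auto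
        then show "y \<in> (T \<inter> ball x r) - {x}"
          using e(2)[of y] nu[of u] r by (auto simp: sgn_scaleR_unit dist_norm)
      qed
    qed
    then show ?thesis using components_cone[OF finite_dirs nu r(1)] by simp
  qed
  show ?thesis unfolding tdeg_def
  proof (rule the_equality)
    show "\<exists>d>0. \<forall>r. 0 < r \<and> r < d \<longrightarrow> card (components (T \<inter> ball x r - {x})) = card (dirs T x)"
      using e(1) * by blast
  next
    fix k assume "\<exists>d>0. \<forall>r. 0 < r \<and> r < d \<longrightarrow> card (components (T \<inter> ball x r - {x})) = k"
    then obtain d where d: "d > 0" "\<And>r. 0 < r \<Longrightarrow> r < d \<Longrightarrow> card (components (T \<inter> ball x r - {x})) = k" by blast
    define r where "r = min d e / 2"
    have "0 < r" "r < d" "r < e" using d(1) e(1) by (auto simp: r_def)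
    then show "k = card (dirs T x)" using d(2)[of r] *[of r] by simp
  qed
qed

section \<open>Graph cycles as simple loops; branch points against leaves\<close>

context polygonal
begin

text \<open>The last conclusion carries the induction: every point of the arc lies on a segment
  between members of the list, so by \<open>adj_segments_cross\<close> a new first segment meets the
  old arc only in their common end.\<close>

lemma arc_along_path:
  assumes "2 \<le> length xs" "distinct xs" "successively adj xs"
  shows "\<exists>g. arc g \<and> pathstart g = hd xs \<and> pathfinish g = last xs \<and>
    (\<forall>p\<in>path_image g. \<exists>a\<in>set xs. \<exists>b\<in>set xs. adj a b \<and> p \<in> closed_segment a b)"
  using assms
proof (induction xs rule: induct_list012)
  case (3 x y zs)
  have xy: "adj x y" "x \<noteq> y" using 3 by auto
  show ?case
  proof (cases zs)
    case Nil
    then show ?thesis using xy by (intro exI[of _ "linepath x y"]) (auto simp: arc_linepath)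
  next
    case (Cons z zs')
    have "2 \<le> length (y # zs)" "distinct (y # zs)" "successively adj (y # zs)" using 3 Cons by auto
    from "3.IH"(2)[OF this] obtain g where g: "arc g" "pathstart g = y" "pathfinish g = last (y # zs)"
      "\<And>p. p \<in> path_image g \<Longrightarrow> \<exists>a\<in>set (y # zs). \<exists>b\<in>set (y # zs). adj a b \<and> p \<in> closed_segment a b"
      by auto
    have xn: "x \<notin> set (y # zs)" using 3 by simp
    have "path_image (linepath x y) \<inter> path_image g \<subseteq> {y}"
    proof
      fix p assume p: "p \<in> path_image (linepath x y) \<inter> path_image g"
      then obtain a b where ab: "a \<in> set (y # zs)" "b \<in> set (y # zs)" "adj a b" "p \<in> closed_segment a b"
        using g(4) by blast
      have "x \<noteq> a" "x \<noteq> b" using ab xn by auto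
      then show "p \<in> {y}" using adj_segments_cross[OF xy(1) ab(3)] ab(4) p by auto
    qed
    then have "arc (linepath x y +++ g)" using g xy by (intro arc_join) (auto simp: arc_linepath)
    moreover have "\<forall>p\<in>path_image (linepath x y +++ g). \<exists>a\<in>set (x # y # zs). \<exists>b\<in>set (x # y # zs). adj a b \<and> p \<in> closed_segment a b"
    proof
      fix p assume "p \<in> path_image (linepath x y +++ g)"
      then consider "p \<in> closed_segment x y" | "p \<in> path_image g"
        using g(2) by (auto simp: path_image_join)
      then show "\<exists>a\<in>set (x # y # zs). \<exists>b\<in>set (x # y # zs). adj a b \<and> p \<in> closed_segment a b"
      proof cases
        case 1
        then show ?thesis using xy(1) by (intro bexI[of _ x] bexI[of _ y] conjI) simp_all
      next
        case 2
        from g(4)[OF this] obtain a b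
          where ab: "a \<in> set (y # zs)" "b \<in> set (y # zs)" "adj a b" "p \<in> closed_segment a b" by blast
        show ?thesis
          by (rule bexI[of _ a], rule bexI[of _ b]) (use ab in simp_all)
      qed
    qed
    moreover have "last (x # y # zs) = last (y # zs)" "hd (x # y # zs) = x" by simp_all
    ultimately show ?thesis using g(3)
      by (intro exI[of _ "linepath x y +++ g"]) (simp only: pathstart_join pathfinish_join pathstart_linepath simp_thms)
  qed
qed auto

text \<open>The loop is joined from two arcs that meet only in their ends: one along
  \<open>xs\<close>, and one through \<open>v\<close> over the two remaining edges.\<close>

lemma cycle_imp_simple_loop:
  assumes d: "distinct (v # xs)" and l: "2 \<le> length xs" and s: "successively adj (v # xs)"
    and c: "adj (last xs) v"
  shows "\<exists>g. simple_path g \<and> pathfinish g = pathstart g \<and> path_image g \<subseteq> T"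
proof -
  obtain y ys where xs: "xs = y # ys" using l by (cases xs) auto
  then have ys: "ys \<noteq> []" using l by auto
  let ?w = "last xs"
  have wxs: "?w \<in> set ys" using xs ys by simp
  have yw: "y \<noteq> ?w" "v \<noteq> y" "v \<noteq> ?w" using d xs wxs by auto
  have vy: "adj v y" using s xs by simp
  have "distinct xs" "successively adj xs" using d s by (auto simp: successively_Cons)
  then obtain g where g: "arc g" "pathstart g = y" "pathfinish g = ?w"
      "\<And>p. p \<in> path_image g \<Longrightarrow> \<exists>a\<in>set xs. \<exists>b\<in>set xs. adj a b \<and> p \<in> closed_segment a b"
    using arc_along_path[OF l] xs by auto
  define h where "h = linepath ?w v +++ linepath v y"
  have "closed_segment ?w v \<inter> closed_segment v y \<subseteq> {v}"
    using adj_segments_cross[OF c vy] yw by (auto simp: doubleton_eq_iff)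
  then have h: "arc h" unfolding h_def using yw by (intro arc_join) (auto simp: arc_linepath)
  have ph: "path_image h = closed_segment ?w v \<union> closed_segment v y"
    by (simp add: h_def path_image_join)
  have "path_image g \<inter> path_image h \<subseteq> {y, ?w}"
  proof
    fix p assume p: "p \<in> path_image g \<inter> path_image h"
    then obtain a b where ab: "a \<in> set xs" "b \<in> set xs" "adj a b" "p \<in> closed_segment a b" using g(4) by blast
    have n: "a \<noteq> v" "b \<noteq> v" using ab d by auto
    show "p \<in> {y, ?w}"
      using p ab(4) n adj_segments_cross[OF c ab(3)] adj_segments_cross[OF vy ab(3)]
      unfolding ph by (auto simp: doubleton_eq_iff)
  qed
  then have "simple_path (g +++ h)"
    using g h by (intro simple_path_join_loop) (auto simp: h_def)
  moreover have "path_image (g +++ h) \<subseteq> T"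
  proof -
    have "path_image g \<subseteq> T" using g(4) unfolding adj_def by blast
    moreover have "path_image h \<subseteq> T" using c vy unfolding ph adj_def by blast
    ultimately show ?thesis using g by (simp add: path_image_join h_def)
  qed
  ultimately show ?thesis using g by (intro exI[of _ "g +++ h"]) (simp add: h_def)
qed

lemma isolated_point:
  assumes "connected T" "x \<in> T" "dirs T x = {}" shows "T = {x}"
proof -
  obtain e where e: "e > 0" "\<And>y. 0 < dist x y \<Longrightarrow> dist x y < e \<Longrightarrow> (y \<in> T \<longleftrightarrow> sgn (y - x) \<in> dirs T x)"
    using conic by blast
  have "\<not> x islimpt T" using e assms(3) by (metis dist_commute dist_pos_lt empty_iff islimpt_approachable)
  then show ?thesis using connected_imp_perfect[OF assms(1)] assms(2) by blast
qed

text \<open>The \<open>adj\<close> graph is a forest, so its degree sum stays below twice its number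
  of vertices. A branch point exceeds degree two by at least one and a leaf falls short by one, so
  leaves must compensate for branch points.\<close>

lemma card_branch_points_le_leaves:
  assumes con: "connected T"
    and acyclic: "\<nexists>g. simple_path g \<and> pathfinish g = pathstart g \<and> path_image g \<subseteq> T"
  shows "finite {x \<in> T. 3 \<le> card (dirs T x)}"
    and "card {x \<in> T. 3 \<le> card (dirs T x)} \<le> card {x \<in> T. card (dirs T x) = 1}"
proof -
  let ?W = "irregular T" and ?B = "{x \<in> T. 3 \<le> card (dirs T x)}" and ?L = "{x \<in> T. card (dirs T x) = 1}"
  have two: "card (dirs T x) = 2" if x: "x \<in> T - ?W" for x
  proof -
    obtain u where u: "dirs T x = {u, -u}" using x by (auto simp: irregular_def)
    then have "norm u = 1" by (auto simp: dirs_def)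
    have "u \<noteq> - u"
    proof
      assume "u = - u"
      then have "u + u = u + (- u)" by simp
      then have "2 *\<^sub>R u = 0" by (simp add: scaleR_2)
      then show False using \<open>norm u = 1\<close> by simp
    qed
    then show ?thesis using u by simp
  qed
  have sub: "?B \<subseteq> ?W" "?L \<subseteq> ?W" using two by force+
  show "finite ?B" using sub finite_irregular finite_subset by blast
  show "card ?B \<le> card ?L"
  \<comment> \<open>An isolated point falls short of degree two by two and would spoil the sum
    below; but then \<open>T\<close> is that point alone and has no branch point.\<close>
  proof (cases "?W = {} \<or> (\<exists>x\<in>T. dirs T x = {})")
    case True
    then have "?B = {}" using sub isolated_point[OF con] by force
    then show ?thesis by (simp only: card.empty le0)
  next
    case False
    \<comment> \<open>Otherwise some nonempty subgraph has all degrees at least two, hence a cycle,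
      hence a simple loop in \<open>T\<close>.\<close>
    have lt: "(\<Sum>v\<in>?W. card {w \<in> ?W. adj v w}) < 2 * card ?W"
    proof (rule ccontr)
      have sy: "symp adj" "irreflp adj" by (auto intro: sympI adj_sym) (simp add: irreflp_def adj_def)
      assume "\<not> ?thesis"
      then have "2 * card ?W \<le> (\<Sum>v\<in>?W. card {w \<in> ?W. adj v w})" by simp
      from min_degree_subgraph[OF finite_irregular _ sy this] False
      obtain W where W: "W \<subseteq> ?W" "W \<noteq> {}" "\<forall>v\<in>W. 2 \<le> card {w \<in> W. adj v w}" by blast
      then obtain v xs where "distinct (v # xs)" "2 \<le> length xs" "successively adj (v # xs)" "adj (last xs) v"
        using ex_cycle[OF finite_subset[OF W(1) finite_irregular] W(2) sy W(3)] by blast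
      from cycle_imp_simple_loop[OF this] show False using acyclic by blast
    qed
    have "(\<Sum>x\<in>?W. 2 + (if x \<in> ?B then 1 else 0)) \<le> (\<Sum>x\<in>?W. card (dirs T x) + (if x \<in> ?L then 1 else 0))"
    proof (rule sum_mono)
      fix x assume x: "x \<in> ?W"
      then have "x \<in> T" by (simp add: irregular_def)
      then have "card (dirs T x) \<noteq> 0" using False finite_dirs by simp
      then show "2 + (if x \<in> ?B then 1 else 0) \<le> card (dirs T x) + (if x \<in> ?L then 1 else 0)"
        using \<open>x \<in> T\<close> by auto
    qed
    moreover have ind: "(\<Sum>x\<in>?W. c x + (if x \<in> X then 1 else 0)) = (\<Sum>x\<in>?W. c x) + card X"
      if "X \<subseteq> ?W" for c :: "'a \<Rightarrow> nat" and X
      using that finite_irregular by (simp add: sum.distrib sum.If_cases Int_absorb1)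
    have "(\<Sum>x\<in>?W. 2 + (if x \<in> ?B then 1 else 0)) = 2 * card ?W + card ?B"
      using ind[OF sub(1), of "\<lambda>_. 2"] by simp
    moreover note ind[OF sub(2), of "\<lambda>x. card (dirs T x)"]
    moreover have "(\<Sum>x\<in>?W. card (dirs T x)) \<le> (\<Sum>v\<in>?W. card {w \<in> ?W. adj v w})"
      by (intro sum_mono card_dirs_le_degree)
    ultimately show ?thesis using lt by linarith
  qed
qed

end

section \<open>Isometries and the local shape of a polytope\<close>

text \<open>\<open>L\<close> is prescribed on a basis of \<open>span Y\<close> taken from
  \<open>Y\<close>. On the rest of \<open>Y\<close> it agrees with \<open>k\<close>, because the
  inner products of \<open>k y\<close> and \<open>L y\<close> with themselves and with each other
  all equal \<open>y \<bullet> y\<close>, so their difference has norm zero.\<close>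

lemma isometry_on_extends_linear:
  fixes Y :: "'a::euclidean_space set" and k :: "'a \<Rightarrow> 'b::euclidean_space"
  assumes ip: "\<And>y z. y \<in> Y \<Longrightarrow> z \<in> Y \<Longrightarrow> k y \<bullet> k z = y \<bullet> z"
  obtains L where "linear L" "\<And>y. y \<in> Y \<Longrightarrow> L y = k y" "\<And>v. v \<in> span Y \<Longrightarrow> norm (L v) = norm v"
proof -
  obtain B where B: "B \<subseteq> Y" "independent B" "Y \<subseteq> span B"
    using maximal_independent_subset[of Y] by blast
  have fB: "finite B" using B(2) by (rule independent_imp_finite)
  obtain L where L: "linear L" "\<And>b. b \<in> B \<Longrightarrow> L b = k b"
    using linear_independent_extend[OF B(2), of k] by blast
  have Lsum: "L (\<Sum>b\<in>B. c b *\<^sub>R b) = (\<Sum>b\<in>B. c b *\<^sub>R k b)" for c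
    using L by (simp add: linear_sum linear_scale)
  have rep: "\<exists>c. v = (\<Sum>b\<in>B. c b *\<^sub>R b)" if "v \<in> span B" for v
    using that unfolding span_finite[OF fB] by auto
  have nrm: "norm (L v) = norm v" if v: "v \<in> span B" for v
  proof -
    obtain c where c: "v = (\<Sum>b\<in>B. c b *\<^sub>R b)" using rep[OF v] by blast
    have "L v \<bullet> L v = (\<Sum>b\<in>B. c b * (\<Sum>b'\<in>B. c b' * (k b' \<bullet> k b)))"
      unfolding c Lsum by (simp add: inner_sum_left inner_sum_right)
    also have "\<dots> = (\<Sum>b\<in>B. c b * (\<Sum>b'\<in>B. c b' * (b' \<bullet> b)))"
      using B(1) ip by (intro sum.cong refl arg_cong2[where f="(*)"]) (simp add: subset_iff)
    also have "\<dots> = v \<bullet> v" unfolding c by (simp add: inner_sum_left inner_sum_right)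
    finally show ?thesis by (simp add: norm_eq_sqrt_inner)
  qed
  have eq: "L y = k y" if y: "y \<in> Y" for y
  proof -
    obtain c where c: "y = (\<Sum>b\<in>B. c b *\<^sub>R b)" using rep y B(3) by blast
    have kL: "k z \<bullet> L y = z \<bullet> y" if z: "z \<in> Y" for z
    proof -
      have "k z \<bullet> L y = (\<Sum>b\<in>B. c b * (k z \<bullet> k b))"
        by (subst c) (simp add: Lsum inner_sum_right)
      also have "\<dots> = (\<Sum>b\<in>B. c b * (z \<bullet> b))"
        using B(1) ip z by (intro sum.cong refl) (simp add: subset_iff)
      also have "\<dots> = z \<bullet> y" by (subst c) (simp add: inner_sum_right)
      finally show ?thesis .
    qed
    have "L y \<bullet> L y = y \<bullet> y" using nrm[of y] y B(3) by (auto simp: norm_eq_sqrt_inner)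
    then have "(k y - L y) \<bullet> (k y - L y) = 0"
      using kL[OF y] ip[OF y y] by (simp add: inner_diff_left inner_diff_right inner_commute)
    then show ?thesis by simp
  qed
  have "span Y = span B" using B by (meson span_eq span_superset subset_trans)
  then show ?thesis using that[OF L(1) eq] nrm by blast
qed

text \<open>\<open>h\<close> is isometric on \<open>X\<close> only. Distances from a base point
  \<open>a\<close> give inner products by polarization, so on \<open>X\<close> it agrees with an
  affine map.\<close>

lemma measure_isometric_image:
  fixes h :: "real^'n::{finite,wellorder} \<Rightarrow> real^'n::_"
  assumes X: "X \<in> lmeasurable" and h: "\<And>x y. x \<in> X \<Longrightarrow> y \<in> X \<Longrightarrow> dist (h x) (h y) = dist x y"
  shows "h ` X \<in> lmeasurable \<and> measure lebesgue (h ` X) = measure lebesgue X"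
proof (cases "X = {}")
  case False
  then obtain a where a: "a \<in> X" by blast
  define Y where "Y = (\<lambda>x. x - a) ` X"
  define k where "k y = h (y + a) - h a" for y
  have "k y \<bullet> k z = y \<bullet> z" if yz: "y \<in> Y" "z \<in> Y" for y z
  proof -
    have "norm (k y) = norm y" "norm (k z) = norm z" "norm (k y - k z) = norm (y - z)"
      using h a yz by (auto simp: k_def Y_def dist_norm)
    then show ?thesis by (simp add: dot_norm_neg)
  qed
  then obtain L where L: "linear L" "\<And>y. y \<in> Y \<Longrightarrow> L y = k y" "\<And>v. v \<in> span Y \<Longrightarrow> norm (L v) = norm v"
    using isometry_on_extends_linear by blast
  have Ym: "Y \<in> lmeasurable" "measure lebesgue Y = measure lebesgue X"
    unfolding Y_def using X by (auto simp: measurable_translation_subtract measure_translation_subtract)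
  have img: "h ` X = (+) (h a) ` (L ` Y)"
    using L(2) by (auto simp: Y_def k_def image_iff intro!: bexI)
  have "L ` Y \<in> lmeasurable \<and> measure lebesgue (L ` Y) = measure lebesgue Y"
  \<comment> \<open>If \<open>Y\<close> does not span, \<open>L\<close> need not preserve norms off
    \<open>span Y\<close>, but then \<open>Y\<close> and its image are both null sets.\<close>
  proof (cases "span Y = UNIV")
    case True
    then have "orthogonal_transformation L" using L by (simp add: orthogonal_transformation)
    then show ?thesis using Ym measurable_orthogonal_image measure_orthogonal_image by blast
  next
    case False
    then have d: "dim Y < DIM((real,'n) vec)" by (metis dim_eq_full dim_subset_UNIV le_neq_implies_less)
    have "negligible Y" by (rule negligible_lowdim[OF d])
    moreover have "dim (L ` Y) \<le> dim Y" using L(1) by (rule dim_image_le)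
    then have "negligible (L ` Y)" by (intro negligible_lowdim) (use d in simp)
    ultimately show ?thesis using negligible_imp_measure0 negligible_imp_measurable by metis
  qed
  then show ?thesis unfolding img using Ym measurable_translation measure_translation by metis
qed simp

text \<open>Images of different pieces may overlap, hence only an inequality. Closedness of the
  pieces makes the successive remainders \<open>Y - X\<close> measurable.\<close>

lemma measure_piecewise_isometric_image:
  fixes h :: "real^'n::{finite,wellorder} \<Rightarrow> real^'n::_"
  assumes "finite C" "\<And>X. X \<in> C \<Longrightarrow> closed X"
    and "Y \<in> lmeasurable" "Y \<subseteq> \<Union>C"
    and "\<And>X x y. X \<in> C \<Longrightarrow> x \<in> X \<inter> Y \<Longrightarrow> y \<in> X \<inter> Y \<Longrightarrow> dist (h x) (h y) = dist x y"
  shows "h ` Y \<in> lmeasurable \<and> measure lebesgue (h ` Y) \<le> measure lebesgue Y"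
  using assms
proof (induction C arbitrary: Y)
  case empty
  then show ?case by auto
next
  case (insert X C)
  have Xs: "X \<in> sets lebesgue" using insert.prems(1)[of X] by simp
  have m: "Y \<inter> X \<in> lmeasurable" "Y - X \<in> lmeasurable"
    using insert.prems(2) Xs by (auto intro: fmeasurable_Int_fmeasurable fmeasurable_Diff)
  have 1: "h ` (Y \<inter> X) \<in> lmeasurable \<and> measure lebesgue (h ` (Y \<inter> X)) = measure lebesgue (Y \<inter> X)"
    by (rule measure_isometric_image[OF m(1)]) (use insert.prems(4)[of X] in auto)
  have 2: "h ` (Y - X) \<in> lmeasurable \<and> measure lebesgue (h ` (Y - X)) \<le> measure lebesgue (Y - X)"
  proof (rule insert.IH)
    show "closed X'" if "X' \<in> C" for X' using insert.prems(1) that by simp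
    show "Y - X \<in> lmeasurable" by (rule m(2))
    show "Y - X \<subseteq> \<Union>C" using insert.prems(3) by auto
    show "dist (h x) (h y) = dist x y" if "X' \<in> C" "x \<in> X' \<inter> (Y - X)" "y \<in> X' \<inter> (Y - X)" for X' x y
      using insert.prems(4)[of X' x y] that by blast
  qed
  have img: "h ` Y = h ` (Y \<inter> X) \<union> h ` (Y - X)" by blast
  have "measure lebesgue (h ` Y) \<le> measure lebesgue (h ` (Y \<inter> X)) + measure lebesgue (h ` (Y - X))"
    unfolding img using 1 2 by (intro measure_Un_le) auto
  also have "\<dots> \<le> measure lebesgue (Y \<inter> X) + measure lebesgue (Y - X)" using 1 2 by linarith
  also have "\<dots> = measure lebesgue ((Y \<inter> X) \<union> (Y - X))"
  proof -
    have "(Y - X) - (Y \<inter> X) = Y - X" by blast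
    then show ?thesis using measure_Un2[OF m] by simp
  qed
  also have "(Y \<inter> X) \<union> (Y - X) = Y" by blast
  finally show ?case unfolding img using 1 2 by (auto intro: fmeasurable.Un)
qed

text \<open>The slit ball is starlike about the point \<open>c\<close> opposite to the ray: a
  segment from \<open>c\<close> that hits the ray must also end on it.\<close>

lemma connected_ball_minus_ray:
  fixes v :: "'a::real_normed_vector"
  assumes v: "v \<noteq> 0" and r: "0 < r"
  shows "connected (ball 0 r - (\<lambda>t. t *\<^sub>R v) ` {0..})"
proof -
  define c where "c = - (r / (2 * norm v)) *\<^sub>R v"
  have c: "norm c = r / 2" using v r by (simp add: c_def)
  have "starlike (ball 0 r - (\<lambda>t. t *\<^sub>R v) ` {0..})"
    unfolding starlike_def
  proof (rule bexI[of _ c], rule ballI)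
    show "c \<in> ball 0 r - (\<lambda>t. t *\<^sub>R v) ` {0..}"
    proof -
      have "c \<noteq> t *\<^sub>R v" if "0 \<le> t" for t
      proof
        assume "c = t *\<^sub>R v"
        moreover have "(t + r / (2 * norm v)) *\<^sub>R v = t *\<^sub>R v - c" by (simp add: c_def scaleR_add_left)
        ultimately have "(t + r / (2 * norm v)) *\<^sub>R v = 0" by simp
        moreover have "r / (2 * norm v) > 0" using v r by simp
        ultimately show False using v that by auto
      qed
      then show ?thesis using c r by auto
    qed
    fix y assume y: "y \<in> ball 0 r - (\<lambda>t. t *\<^sub>R v) ` {0..}"
    show "closed_segment c y \<subseteq> ball 0 r - (\<lambda>t. t *\<^sub>R v) ` {0..}"
    proof
      fix p assume p: "p \<in> closed_segment c y"
      have "c \<in> ball 0 r" using c r by auto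
      then have "p \<in> ball 0 r" using p y convex_ball[of 0 r] by (meson DiffD1 closed_segment_subset subsetD)
      moreover have "p \<notin> (\<lambda>t. t *\<^sub>R v) ` {0..}"
      proof
        assume "p \<in> (\<lambda>t. t *\<^sub>R v) ` {0..}"
        then obtain t where t: "0 \<le> t" "p = t *\<^sub>R v" by auto
        obtain s where s: "0 \<le> s" "s \<le> 1" "p = (1 - s) *\<^sub>R c + s *\<^sub>R y" using p by (auto simp: in_segment)
        have rv: "r / (2 * norm v) > 0" using v r by simp
        have eq: "s *\<^sub>R y = (t + (1 - s) * (r / (2 * norm v))) *\<^sub>R v"
          using s(3) t(2) by (simp add: c_def algebra_simps)
        show False
        proof (cases "s = 0")
          case True
          then show False using eq rv t v by auto
        next
          case False
          have "y = (1 / s) *\<^sub>R (s *\<^sub>R y)" using False by simp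
          also have "\<dots> = ((t + (1 - s) * (r / (2 * norm v))) / s) *\<^sub>R v" unfolding eq by simp
          finally have "y = ((t + (1 - s) * (r / (2 * norm v))) / s) *\<^sub>R v" .
          moreover have "(t + (1 - s) * (r / (2 * norm v))) / s \<ge> 0"
            using s t rv r by (intro divide_nonneg_nonneg add_nonneg_nonneg mult_nonneg_nonneg) auto
          ultimately show False using y by auto
        qed
      qed
      ultimately show "p \<in> ball 0 r - (\<lambda>t. t *\<^sub>R v) ` {0..}" by blast
    qed
  qed
  then show ?thesis by (rule starlike_imp_connected)
qed

section \<open>Local coordinates on the surface of a polytope\<close>

lemma orthonormal_3_expansion:
  fixes d w z :: "real^3"
  assumes n: "norm d = 1" "norm w = 1" "norm z = 1" and o: "d \<bullet> w = 0" "d \<bullet> z = 0" "w \<bullet> z = 0"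
  shows "y = (y \<bullet> d) *\<^sub>R d + (y \<bullet> w) *\<^sub>R w + (y \<bullet> z) *\<^sub>R z"
proof -
  have nn: "d \<bullet> d = 1" "w \<bullet> w = 1" "z \<bullet> z = 1" using n by (simp_all add: norm_eq_1)
  have o': "w \<bullet> d = 0" "z \<bullet> d = 0" "z \<bullet> w = 0" using o by (simp_all add: inner_commute)
  have ne: "d \<noteq> w" "d \<noteq> z" "w \<noteq> z" using o nn by auto
  have "pairwise orthogonal {d,w,z}"
    using o by (auto simp: pairwise_def orthogonal_def inner_commute)
  moreover have "0 \<notin> {d,w,z}" using n by auto
  ultimately have ind: "independent {d,w,z}" by (rule pairwise_orthogonal_independent)
  have "card {d,w,z} = 3" using ne by simp
  then have "dim (UNIV :: (real^3) set) \<le> card {d,w,z}" by (simp add: dim_UNIV)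
  then have sp: "UNIV \<subseteq> span {d,w,z}" using card_ge_dim_independent[OF _ ind, of UNIV] by simp
  let ?e = "y - ((y \<bullet> d) *\<^sub>R d + (y \<bullet> w) *\<^sub>R w + (y \<bullet> z) *\<^sub>R z)"
  have "orthogonal ?e u" if "u \<in> {d,w,z}" for u
    using that o o' nn by (auto simp: orthogonal_def inner_diff_left inner_add_left)
  then have "orthogonal ?e ?e" using orthogonal_to_span[of ?e "{d,w,z}" ?e] sp by blast
  then show ?thesis by (simp add: orthogonal_def)
qed

lemma ex_orthonormal_completion:
  fixes d z :: "real^3"
  assumes "norm d = 1" "norm z = 1" "d \<bullet> z = 0"
  obtains w where "norm w = 1" "d \<bullet> w = 0" "w \<bullet> z = 0"
proof
  have "(norm (cross3 d z))\<^sup>2 = 1" using norm_cross_dot[of d z] assms by simp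
  then show "norm (cross3 d z) = 1" using norm_ge_zero[of "cross3 d z"] by (simp add: power2_eq_1_iff)
  show "d \<bullet> cross3 d z = 0" "cross3 d z \<bullet> z = 0" by (simp_all add: dot_cross_self)
qed

text \<open>A boundary point that is not a vertex lies on a line contained in the tangent cone of \<open>Q\<close>,
  so in suitable coordinates \<open>Q\<close> is locally the epigraph of the maximum of linear functions of one variable.\<close>

lemma polytope_local_graph:
  fixes Q :: "(real^3) set"
  assumes Q: "polytope Q" "interior Q \<noteq> {}" and x: "x \<in> frontier Q" "\<not> x extreme_point_of Q"
  obtains r d w z and \<alpha> \<beta> :: real where "r > 0" "norm d = 1" "norm w = 1" "norm z = 1"
    "d \<bullet> w = 0" "d \<bullet> z = 0" "w \<bullet> z = 0"
    "\<And>y. dist x y < r \<Longrightarrow> y \<in> frontier Q \<longleftrightarrow>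
       (y - x) \<bullet> z = (if (y - x) \<bullet> w \<ge> 0 then \<alpha> * ((y - x) \<bullet> w) else \<beta> * ((y - x) \<bullet> w))"
proof -
  have clQ: "closed Q" using Q by (simp add: polytope_imp_closed)
  have frQ: "frontier Q = Q - interior Q" using clQ by (simp add: frontier_def)
  obtain F where F: "finite F" "Q = \<Inter>F" "\<And>h. h \<in> F \<Longrightarrow> \<exists>a b. a \<noteq> 0 \<and> h = {x. a \<bullet> x \<le> b}"
    using polytope_imp_polyhedron[OF Q(1)] by (auto simp: polyhedron_def)
  obtain a b where ab: "\<And>h. h \<in> F \<Longrightarrow> a h \<noteq> 0 \<and> h = {x. a h \<bullet> x \<le> b h}" using F(3) by metis
  have Qiff: "y \<in> Q \<longleftrightarrow> (\<forall>h\<in>F. a h \<bullet> y \<le> b h)" for y using F(2) ab by blast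
  have xQ: "x \<in> Q" using x frQ by blast
  \<comment> \<open>The constraints active at \<open>x\<close>; near \<open>x\<close> they alone cut
    out \<open>Q\<close>.\<close>
  define I where "I = {h \<in> F. a h \<bullet> x = b h}"
  have fI: "finite I" using F by (simp add: I_def)
  have "\<exists>r>0. \<forall>y. dist x y < r \<longrightarrow> (\<forall>h\<in>F - I. a h \<bullet> y < b h)"
  proof -
    have "open (\<Inter>h\<in>F - I. {y. a h \<bullet> y < b h})"
      using F(1) by (intro open_INT) (auto intro: open_halfspace_lt)
    moreover have "x \<in> (\<Inter>h\<in>F - I. {y. a h \<bullet> y < b h})"
      using xQ Qiff by (force simp: I_def)
    ultimately obtain r where "r > 0" "ball x r \<subseteq> (\<Inter>h\<in>F - I. {y. a h \<bullet> y < b h})" by (meson openE)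
    then show ?thesis by (intro exI[of _ r]) (auto simp: subset_iff)
  qed
  then obtain r where r: "r > 0" "\<And>y h. dist x y < r \<Longrightarrow> h \<in> F - I \<Longrightarrow> a h \<bullet> y < b h" by blast
  have loc: "y \<in> Q \<longleftrightarrow> (\<forall>h\<in>I. a h \<bullet> (y - x) \<le> 0)" if y: "dist x y < r" for y
  proof -
    have "y \<in> Q \<longleftrightarrow> (\<forall>h\<in>I. a h \<bullet> y \<le> b h)"
      unfolding Qiff using r(2)[OF y] by (force simp: I_def)
    then show ?thesis by (simp add: I_def inner_diff_right)
  qed
  have intl: "y \<in> interior Q \<longleftrightarrow> (\<forall>h\<in>I. a h \<bullet> (y - x) < 0)" if y: "dist x y < r" for y
  proof
    assume yi: "y \<in> interior Q"
    show "\<forall>h\<in>I. a h \<bullet> (y - x) < 0"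
    proof
      fix h assume h: "h \<in> I"
      then have hF: "h \<in> F" "b h = a h \<bullet> x" by (auto simp: I_def)
      have "interior Q \<subseteq> interior {x. a h \<bullet> x \<le> b h}" using F(2) hF ab by (intro interior_mono) blast
      then have "a h \<bullet> y < b h"
        using yi interior_halfspace_le[OF ab[OF hF(1), THEN conjunct1], of "b h"] by blast
      then show "a h \<bullet> (y - x) < 0" using hF by (simp add: inner_diff_right)
    qed
  next
    assume lt: "\<forall>h\<in>I. a h \<bullet> (y - x) < 0"
    have "open (ball x r \<inter> (\<Inter>h\<in>I. {y. a h \<bullet> y < a h \<bullet> x}))"
      using fI by (intro open_Int open_INT) (auto intro: open_halfspace_lt)
    moreover have "ball x r \<inter> (\<Inter>h\<in>I. {y. a h \<bullet> y < a h \<bullet> x}) \<subseteq> Q"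
      using loc by (force simp: inner_diff_right)
    moreover have "y \<in> ball x r \<inter> (\<Inter>h\<in>I. {y. a h \<bullet> y < a h \<bullet> x})"
      using lt y by (auto simp: inner_diff_right)
    ultimately show "y \<in> interior Q" by (meson interiorI)
  qed
  have Ine: "I \<noteq> {}" using intl[of x] r x frQ by auto
  \<comment> \<open>Every active constraint attains its bound at \<open>x\<close>, inside the
    segment from \<open>p\<close> to \<open>q\<close>, and is therefore constant along the direction
    \<open>d\<close> of the segment.\<close>
  obtain p q where pq: "p \<in> Q" "q \<in> Q" "x \<in> open_segment p q"
    using x(2) xQ by (auto simp: extreme_point_of_def)
  define d where "d = sgn (q - p)"
  have pqn: "p \<noteq> q" using pq by auto
  have nd: "norm d = 1" using pqn by (simp add: d_def norm_sgn)
  have ad: "a h \<bullet> d = 0" if h: "h \<in> I" for h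
  proof -
    obtain t where t: "0 < t" "t < 1" "x = (1 - t) *\<^sub>R p + t *\<^sub>R q" using pq by (auto simp: in_segment)
    have hF: "h \<in> F" "a h \<bullet> x = b h" using h by (auto simp: I_def)
    have "a h \<bullet> p \<le> b h" "a h \<bullet> q \<le> b h" using pq Qiff hF by auto
    moreover have "b h = (1 - t) * (a h \<bullet> p) + t * (a h \<bullet> q)"
      using hF(2) t(3) by (simp add: inner_add_right)
    moreover have "(1 - t) * (b h - a h \<bullet> p) \<ge> 0" "t * (b h - a h \<bullet> q) \<ge> 0" using calculation t by auto
    ultimately have "(1 - t) * (b h - a h \<bullet> p) = 0" "t * (b h - a h \<bullet> q) = 0"
      by (auto simp: algebra_simps)
    then have "a h \<bullet> p = a h \<bullet> q" using t by auto
    then show ?thesis by (simp add: d_def sgn_div_norm inner_diff_right)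
  qed
  obtain c where c: "c \<in> interior Q" using Q by blast
  \<comment> \<open>The direction to an interior point, made orthogonal to \<open>d\<close>. All
    active functionals are negative on it, so it can serve as the vertical axis.\<close>
  define c' where "c' = (c - x) - ((c - x) \<bullet> d) *\<^sub>R d"
  have ac: "a h \<bullet> c' < 0" if h: "h \<in> I" for h
  proof -
    have hF: "h \<in> F" "b h = a h \<bullet> x" using h by (auto simp: I_def)
    have "interior Q \<subseteq> interior {x. a h \<bullet> x \<le> b h}" using F(2) hF ab by (intro interior_mono) blast
    then have "a h \<bullet> c < b h"
      using c interior_halfspace_le[OF ab[OF hF(1), THEN conjunct1], of "b h"] by blast
    then show ?thesis using ad[OF h] hF by (simp add: c'_def inner_diff_right)
  qed
  have c'0: "c' \<noteq> 0" using ac Ine by force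
  define z where "z = sgn c'"
  have nz: "norm z = 1" using c'0 by (simp add: z_def norm_sgn)
  have az: "a h \<bullet> z < 0" if "h \<in> I" for h
    using ac[OF that] c'0 by (simp add: z_def sgn_div_norm mult_pos_neg)
  have "d \<bullet> c' = 0" using nd by (simp add: c'_def inner_diff_right norm_eq_1 inner_commute)
  then have dz: "d \<bullet> z = 0" by (simp add: z_def sgn_div_norm)
  obtain w where w: "norm w = 1" "d \<bullet> w = 0" "w \<bullet> z = 0" using ex_orthonormal_completion[OF nd nz dz] .
  \<comment> \<open>An active constraint bounds the height from below by a linear function of the
    \<open>w\<close> coordinate, and \<open>s h\<close> is its slope. The maximum of these functions
    is governed by the largest slope where the coordinate is nonnegative and by the smallest where
    it is negative.\<close>
  define s where "s h = (a h \<bullet> w) / (- (a h \<bullet> z))" for h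
  have ay: "a h \<bullet> v = (- (a h \<bullet> z)) * (s h * (v \<bullet> w) - v \<bullet> z)" if h: "h \<in> I" for h v
  proof -
    have "a h \<bullet> v = (v \<bullet> w) * (a h \<bullet> w) + (v \<bullet> z) * (a h \<bullet> z)"
      by (subst orthonormal_3_expansion[OF nd w(1) nz w(2) dz w(3), of v]) (simp add: inner_add_right ad[OF h])
    then show ?thesis using az[OF h] by (simp add: s_def field_simps)
  qed
  define \<alpha> where "\<alpha> = Max (s ` I)"
  define \<beta> where "\<beta> = Min (s ` I)"
  have ab': "\<beta> \<le> s h" "s h \<le> \<alpha>" if "h \<in> I" for h using fI that by (auto simp: \<alpha>_def \<beta>_def)
  obtain h1 h2 where h12: "h1 \<in> I" "s h1 = \<alpha>" "h2 \<in> I" "s h2 = \<beta>"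
  proof -
    have "\<alpha> \<in> s ` I" "\<beta> \<in> s ` I" unfolding \<alpha>_def \<beta>_def using fI Ine by auto
    then show ?thesis using that by auto
  qed
  have main: "y \<in> frontier Q \<longleftrightarrow>
       (y - x) \<bullet> z = (if (y - x) \<bullet> w \<ge> 0 then \<alpha> * ((y - x) \<bullet> w) else \<beta> * ((y - x) \<bullet> w))"
    if y: "dist x y < r" for y
  proof -
    define P where "P = (y - x) \<bullet> w"
    define Z where "Z = (y - x) \<bullet> z"
    have le: "a h \<bullet> (y - x) \<le> 0 \<longleftrightarrow> s h * P \<le> Z" if "h \<in> I" for h
      unfolding ay[OF that, of "y - x"] P_def Z_def using az[OF that] by (auto simp: zero_le_mult_iff)
    have lt: "a h \<bullet> (y - x) < 0 \<longleftrightarrow> s h * P < Z" if "h \<in> I" for h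
      unfolding ay[OF that, of "y - x"] P_def Z_def using az[OF that] by (auto simp: zero_less_mult_iff)
    define m where "m = (if P \<ge> 0 then \<alpha> * P else \<beta> * P)"
    have mle: "s h * P \<le> m" if "h \<in> I" for h
      using ab'[OF that] by (auto simp: m_def mult_right_mono mult_right_mono_neg)
    have "s (if P \<ge> 0 then h1 else h2) * P = m" "(if P \<ge> 0 then h1 else h2) \<in> I"
      using h12 by (simp_all add: m_def)
    then obtain h where h: "h \<in> I" "s h * P = m" by blast
    have "y \<in> frontier Q \<longleftrightarrow> (\<forall>h\<in>I. s h * P \<le> Z) \<and> \<not> (\<forall>h\<in>I. s h * P < Z)"
      unfolding frQ using loc[OF y] intl[OF y] le lt by auto
    also have "\<dots> \<longleftrightarrow> Z = m" using mle h by fastforce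
    finally show ?thesis unfolding m_def P_def Z_def .
  qed
  show ?thesis by (rule that[OF r(1) nd w(1) nz w(2) dz w(3) main])
qed

text \<open>Near \<open>x\<close> the surface is two half planes joined along a line, possibly in
  one plane, so it unfolds isometrically. \<open>\<phi>\<close> folds the plane back onto it,
  isometrically on each of the half planes \<open>A\<close> and \<open>B\<close>. It keeps distances
  to \<open>x\<close> and rays from \<open>x\<close>, so discs and straight germs at
  \<open>x\<close> can be read off in the plane.\<close>

lemma polytope_chart:
  fixes Q :: "(real^3) set"
  assumes Q: "polytope Q" "interior Q \<noteq> {}" and x: "x \<in> frontier Q" "\<not> x extreme_point_of Q"
  obtains r and \<phi> :: "real^2 \<Rightarrow> real^3" and \<psi> A B where "r > 0"
    "continuous_on UNIV \<phi>" "continuous_on UNIV \<psi>" "\<And>v. \<psi> (\<phi> v) = v"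
    "\<And>v. dist x (\<phi> v) = norm v" "\<And>t v. 0 \<le> t \<Longrightarrow> \<phi> (t *\<^sub>R v) = x + t *\<^sub>R (\<phi> v - x)"
    "\<phi> ` ball 0 r = frontier Q \<inter> ball x r" "closed A" "closed B" "A \<union> B = UNIV"
    "\<And>v w. v \<in> A \<Longrightarrow> w \<in> A \<Longrightarrow> dist (\<phi> v) (\<phi> w) = dist v w"
    "\<And>v w. v \<in> B \<Longrightarrow> w \<in> B \<Longrightarrow> dist (\<phi> v) (\<phi> w) = dist v w"
proof -
  obtain r d w z and \<alpha> \<beta> :: real where r: "r > 0" and n: "norm d = 1" "norm w = 1" "norm z = 1"
    and o: "d \<bullet> w = 0" "d \<bullet> z = 0" "w \<bullet> z = 0" and
    fr: "\<And>y. dist x y < r \<Longrightarrow> y \<in> frontier Q \<longleftrightarrow>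
       (y - x) \<bullet> z = (if (y - x) \<bullet> w \<ge> 0 then \<alpha> * ((y - x) \<bullet> w) else \<beta> * ((y - x) \<bullet> w))"
    using polytope_local_graph[OF assms] by blast
  have nn: "d \<bullet> d = 1" "w \<bullet> w = 1" "z \<bullet> z = 1" using n by (simp_all add: norm_eq_1)
  have o': "w \<bullet> d = 0" "z \<bullet> d = 0" "z \<bullet> w = 0" using o by (simp_all add: inner_commute)
  \<comment> \<open>\<open>a\<close> and \<open>b\<close> normalise, so that \<open>e1\<close> and
    \<open>e2\<close> are unit vectors orthogonal to \<open>d\<close> in the planes of the two
    halves.\<close>
  define a where "a = sqrt (1 + \<alpha>\<^sup>2)"
  define b where "b = sqrt (1 + \<beta>\<^sup>2)"
  have a: "a > 0" "a\<^sup>2 = 1 + \<alpha>\<^sup>2" and b: "b > 0" "b\<^sup>2 = 1 + \<beta>\<^sup>2"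
    by (auto simp: a_def b_def add_pos_nonneg)
  define e1 where "e1 = (1 / a) *\<^sub>R (w + \<alpha> *\<^sub>R z)"
  define e2 where "e2 = (1 / b) *\<^sub>R (w + \<beta> *\<^sub>R z)"
  have "e1 \<bullet> e1 = (1 / a)\<^sup>2 * (1 + \<alpha>\<^sup>2)"
    using nn o o' by (simp add: e1_def inner_add_left inner_add_right power2_eq_square add_divide_distrib)
  also have "\<dots> = 1" using a by (simp add: a(2)[symmetric] power_one_over del: power_divide)
  finally have "e1 \<bullet> e1 = 1" .
  then have e1: "d \<bullet> e1 = 0" "e1 \<bullet> d = 0" "e1 \<bullet> e1 = 1" "e1 \<bullet> w = 1 / a" "e1 \<bullet> z = \<alpha> / a"
    using nn o o' by (simp_all add: e1_def inner_add_left inner_add_right)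
  have "e2 \<bullet> e2 = (1 / b)\<^sup>2 * (1 + \<beta>\<^sup>2)"
    using nn o o' by (simp add: e2_def inner_add_left inner_add_right power2_eq_square add_divide_distrib)
  also have "\<dots> = 1" using b by (simp add: b(2)[symmetric] power_one_over del: power_divide)
  finally have "e2 \<bullet> e2 = 1" .
  then have e2: "d \<bullet> e2 = 0" "e2 \<bullet> d = 0" "e2 \<bullet> e2 = 1" "e2 \<bullet> w = 1 / b" "e2 \<bullet> z = \<beta> / b"
    using nn o o' by (simp_all add: e2_def inner_add_left inner_add_right)
  define \<phi> where "\<phi> v = x + (v $ 1) *\<^sub>R d + (max (v $ 2) 0) *\<^sub>R e1 + (min (v $ 2) 0) *\<^sub>R e2" for v :: "real^2"
  define P where "P y = (y - x) \<bullet> w" for y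
  \<comment> \<open>Projection to the \<open>w\<close> axis shortens by \<open>a\<close> or
    \<open>b\<close> on the two sides; \<open>\<psi>\<close> undoes this.\<close>
  define \<psi> :: "real^3 \<Rightarrow> real^2" where
    "\<psi> y = ((y - x) \<bullet> d) *\<^sub>R axis 1 1 + (a * max (P y) 0 + b * min (P y) 0) *\<^sub>R axis 2 1" for y
  have \<psi>12: "\<psi> y $ 1 = (y - x) \<bullet> d" "\<psi> y $ 2 = a * max (P y) 0 + b * min (P y) 0" for y
    by (simp_all add: \<psi>_def axis_def)
  have nv: "norm v ^ 2 = (v $ 1)\<^sup>2 + (v $ 2)\<^sup>2" for v :: "real^2"
    by (simp add: norm_vec_def L2_set_def sum_2)
  have iso: "norm ((v $ 1) *\<^sub>R d + (v $ 2) *\<^sub>R e) = norm v" if e: "d \<bullet> e = 0" "e \<bullet> d = 0" "e \<bullet> e = 1" for e and v :: "real^2"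
  proof -
    have "norm ((v $ 1) *\<^sub>R d + (v $ 2) *\<^sub>R e) ^ 2 = norm v ^ 2"
      unfolding nv power2_norm_eq_inner using e nn
      by (simp add: inner_add_left inner_add_right power2_eq_square)
    then show ?thesis by simp
  qed
  have \<phi>1: "\<phi> v = x + ((v $ 1) *\<^sub>R d + (v $ 2) *\<^sub>R e1)" if "v $ 2 \<ge> 0" for v
    using that by (simp add: \<phi>_def)
  have \<phi>2: "\<phi> v = x + ((v $ 1) *\<^sub>R d + (v $ 2) *\<^sub>R e2)" if "v $ 2 \<le> 0" for v
    using that by (simp add: \<phi>_def)
  have \<phi>d: "(\<phi> v - x) \<bullet> d = v $ 1" for v
    using nn e1 e2 by (simp add: \<phi>_def inner_add_left)
  have \<phi>w: "P (\<phi> v) = (max (v $ 2) 0) / a + (min (v $ 2) 0) / b" for v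
    using o e1 e2 by (simp add: P_def \<phi>_def inner_add_left)
  have \<phi>z: "(\<phi> v - x) \<bullet> z = \<alpha> * ((max (v $ 2) 0) / a) + \<beta> * ((min (v $ 2) 0) / b)" for v
    using o e1 e2 by (simp add: \<phi>_def inner_add_left mult.commute)
  have 4: "\<psi> (\<phi> v) = v" for v
  proof -
    have "\<psi> (\<phi> v) $ 2 = v $ 2"
    proof (cases "v $ 2 \<ge> 0")
      case True
      then have "P (\<phi> v) = v $ 2 / a" "P (\<phi> v) \<ge> 0" using a by (simp_all add: \<phi>w)
      then show ?thesis using a by (simp add: \<psi>12)
    next
      case False
      then have "P (\<phi> v) = v $ 2 / b" "P (\<phi> v) \<le> 0" using b by (simp_all add: \<phi>w divide_nonpos_pos)
      then show ?thesis using b by (simp add: \<psi>12)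
    qed
    moreover have "\<psi> (\<phi> v) $ 1 = v $ 1" by (simp add: \<psi>12 \<phi>d)
    ultimately show ?thesis by (simp add: vec_eq_iff forall_2)
  qed
  have 5: "dist x (\<phi> v) = norm v" for v
  proof -
    have "norm (\<phi> v - x) = norm v"
      using \<phi>1[of v] \<phi>2[of v] iso[OF e1(1-3), of v] iso[OF e2(1-3), of v]
      by (cases "v $ 2 \<ge> 0") simp_all
    then show ?thesis by (simp only: dist_norm norm_minus_commute)
  qed
  have 6: "\<phi> (t *\<^sub>R v) = x + t *\<^sub>R (\<phi> v - x)" if "0 \<le> t" for t v
  proof -
    have "max (t * v $ 2) 0 = t * max (v $ 2) 0" "min (t * v $ 2) 0 = t * min (v $ 2) 0"
      using that by (simp_all add: max_mult_distrib_left min_mult_distrib_left)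
    then show ?thesis by (simp add: \<phi>_def algebra_simps)
  qed
  have 7: "\<phi> ` ball 0 r = frontier Q \<inter> ball x r"
  proof
    show "\<phi> ` ball 0 r \<subseteq> frontier Q \<inter> ball x r"
    proof
      fix y assume "y \<in> \<phi> ` ball 0 r"
      then obtain v where v: "y = \<phi> v" "norm v < r" by auto
      then have dy: "dist x y < r" using 5 by simp
      have "(y - x) \<bullet> z = (if P y \<ge> 0 then \<alpha> * P y else \<beta> * P y)"
        using a(1) b(1) unfolding v(1) \<phi>z \<phi>w
        by (cases "v $ 2 \<ge> 0") (auto simp: zero_le_divide_iff)
      then show "y \<in> frontier Q \<inter> ball x r" using fr[OF dy] dy by (simp add: P_def)
    qed
    show "frontier Q \<inter> ball x r \<subseteq> \<phi> ` ball 0 r"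
    proof
      fix y assume y: "y \<in> frontier Q \<inter> ball x r"
      then have dy: "dist x y < r" by simp
      have z: "(y - x) \<bullet> z = (if P y \<ge> 0 then \<alpha> * P y else \<beta> * P y)"
        using fr[OF dy] y by (simp add: P_def)
      have ex: "y - x = ((y - x) \<bullet> d) *\<^sub>R d + P y *\<^sub>R w + ((y - x) \<bullet> z) *\<^sub>R z"
        unfolding P_def by (rule orthonormal_3_expansion[OF n o])
      have "y = \<phi> (\<psi> y)"
      proof (cases "P y \<ge> 0")
        case True
        have 2: "\<psi> y $ 2 = a * P y" using True by (simp add: \<psi>12)
        moreover have 3: "P y *\<^sub>R w + ((y - x) \<bullet> z) *\<^sub>R z = (a * P y) *\<^sub>R e1"
          using True a z by (simp add: e1_def algebra_simps)
        moreover have "a * P y \<ge> 0" using True a by simp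
        ultimately have "\<phi> (\<psi> y) = x + (((y - x) \<bullet> d) *\<^sub>R d + (P y *\<^sub>R w + ((y - x) \<bullet> z) *\<^sub>R z))"
          using \<phi>1[of "\<psi> y"] by (simp only: 2 3 \<psi>12(1))
        also have "\<dots> = x + (y - x)" by (simp only: ex[unfolded add.assoc, symmetric])
        finally show ?thesis by simp
      next
        case False
        have 2: "\<psi> y $ 2 = b * P y" using False by (simp add: \<psi>12)
        moreover have 3: "P y *\<^sub>R w + ((y - x) \<bullet> z) *\<^sub>R z = (b * P y) *\<^sub>R e2"
          using False b z by (simp add: e2_def algebra_simps)
        moreover have "b * P y \<le> 0" using False b by (simp add: mult_nonneg_nonpos)
        ultimately have "\<phi> (\<psi> y) = x + (((y - x) \<bullet> d) *\<^sub>R d + (P y *\<^sub>R w + ((y - x) \<bullet> z) *\<^sub>R z))"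
          using \<phi>2[of "\<psi> y"] by (simp only: 2 3 \<psi>12(1))
        also have "\<dots> = x + (y - x)" by (simp only: ex[unfolded add.assoc, symmetric])
        finally show ?thesis by simp
      qed
      moreover have "norm (\<psi> y) < r" using dy 5[of "\<psi> y"] calculation by simp
      ultimately show "y \<in> \<phi> ` ball 0 r" by auto
    qed
  qed
  have 11: "dist (\<phi> v) (\<phi> v') = dist v v'" if "v \<in> {v. v $ 2 \<ge> 0}" "v' \<in> {v. v $ 2 \<ge> 0}" for v v'
  proof -
    have "\<phi> v - \<phi> v' = ((v - v') $ 1) *\<^sub>R d + ((v - v') $ 2) *\<^sub>R e1"
      using that by (simp add: \<phi>1 algebra_simps)
    then show ?thesis using iso[OF e1(1-3), of "v - v'"] by (simp add: dist_norm)
  qed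
  have 12: "dist (\<phi> v) (\<phi> v') = dist v v'" if "v \<in> {v. v $ 2 \<le> 0}" "v' \<in> {v. v $ 2 \<le> 0}" for v v'
  proof -
    have "\<phi> v - \<phi> v' = ((v - v') $ 1) *\<^sub>R d + ((v - v') $ 2) *\<^sub>R e2"
      using that by (simp add: \<phi>2 algebra_simps)
    then show ?thesis using iso[OF e2(1-3), of "v - v'"] by (simp add: dist_norm)
  qed
  have 2: "continuous_on UNIV \<phi>" unfolding \<phi>_def by (intro continuous_intros)
  have 3: "continuous_on UNIV \<psi>" unfolding \<psi>_def P_def by (intro continuous_intros)
  have 8: "closed {v::real^2. v $ 2 \<ge> 0}" "closed {v::real^2. v $ 2 \<le> 0}"
    by (intro closed_Collect_le continuous_intros)+
  have 9: "{v::real^2. v $ 2 \<ge> 0} \<union> {v. v $ 2 \<le> 0} = UNIV" by auto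
  show ?thesis by (rule that[OF r 2 3 4 5 6 7 8 9 11 12])
qed

section \<open>Leaves of cut trees\<close>

lemma compact_simple_polygon:
  assumes "simple_polygon P" shows "compact P"
proof -
  obtain g where g: "simple_path g" "P = path_image g \<union> inside (path_image g)"
    using assms by (auto simp: simple_polygon_def)
  have "path g" using g(1) by (rule simple_path_imp_path)
  then have "closed P" "bounded P"
    using g(2) closed_path_image_Un_inside bounded_inside[OF bounded_path_image] bounded_path_image
    by (auto simp: bounded_Un)
  then show ?thesis by (simp add: compact_eq_bounded_closed)
qed

text \<open>The pieces of an unfolding are arbitrary sets; continuity allows replacing them by their
  closures.\<close>

lemma isometric_on_closure:
  assumes f: "continuous_on P f" and P: "closed P" "X \<subseteq> P"
    and iso: "\<And>x y. x \<in> X \<Longrightarrow> y \<in> X \<Longrightarrow> dist (f x) (f y) = dist x y"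
    and xy: "x \<in> closure X" "y \<in> closure X"
  shows "dist (f x) (f y) = dist x y"
proof -
  have sub: "closure X \<subseteq> P" using P by (simp add: closure_minimal)
  let ?g = "\<lambda>p. dist (f (fst p)) (f (snd p)) - dist (fst p) (snd p)"
  have "continuous_on (closure X \<times> closure X) ?g"
    using sub by (intro continuous_intros continuous_on_compose2[OF f]) auto
  then have "continuous_on (closure (X \<times> X)) ?g" by (simp add: closure_Times)
  moreover have "?g p = 0" if "p \<in> X \<times> X" for p using that iso by auto
  moreover have "(x, y) \<in> closure (X \<times> X)" using xy by (simp add: closure_Times)
  ultimately have "?g (x, y) = 0" by (rule continuous_constant_on_closure)
  then show ?thesis by simp
qed

lemma negligible_ray: "negligible ((\<lambda>t. t *\<^sub>R v) ` S)" for v :: "real^2"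
proof (rule negligible_lowdim)
  have "(\<lambda>t. t *\<^sub>R v) ` S \<subseteq> span {v}" by (auto simp: span_singleton)
  then have "dim ((\<lambda>t. t *\<^sub>R v) ` S) \<le> card {v}" by (intro dim_le_card) auto
  then show "dim ((\<lambda>t. t *\<^sub>R v) ` S) < DIM(real^2)" by simp
qed

text \<open>The part of the ball outside \<open>P\<close> is open and nonempty, hence of positive
  measure.\<close>

lemma measure_ball_Int_less:
  fixes P :: "'a::euclidean_space set"
  assumes P: "closed P" "z \<notin> interior P" and r: "0 < r"
  shows "measure lebesgue (P \<inter> ball z r) < measure lebesgue (ball z r)"
proof -
  have "\<not> ball z r \<subseteq> P" using P(2) r by (metis centre_in_ball interiorI open_ball)
  then have ne: "ball z r - P \<noteq> {}" by blast
  have op: "open (ball z r - P)" using P(1) by (simp add: open_Diff)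
  have "P \<in> sets lebesgue" using P(1) by simp
  then have m: "ball z r - P \<in> lmeasurable" "P \<inter> ball z r \<in> lmeasurable"
    using fmeasurable_Int_fmeasurable[of "ball z r" lebesgue P]
    by (auto intro!: fmeasurable_Diff simp: Int_commute)
  have "measure lebesgue (ball z r - P) > 0"
    using open_not_negligible[OF op ne] m(1) by (simp add: negligible_iff_measure zero_less_measure_iff)
  moreover have "measure lebesgue (ball z r) = measure lebesgue (P \<inter> ball z r) + measure lebesgue (ball z r - P)"
  proof -
    have "ball z r = (P \<inter> ball z r) \<union> (ball z r - P)" "(ball z r - P) - (P \<inter> ball z r) = ball z r - P" by blast+
    then show ?thesis using measure_Un2[OF m(2,1)] by metis
  qed
  ultimately show ?thesis by linarith
qed

text \<open>One set of the cover and the union of the others are two closed sets; they would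
  separate \<open>D\<close> if both met it.\<close>

lemma connected_subset_finite_disjoint_closed:
  assumes D: "connected D" "D \<noteq> {}" and Z: "finite Z" "\<And>z. z \<in> Z \<Longrightarrow> closed (K z)"
    and cover: "D \<subseteq> (\<Union>z\<in>Z. K z)"
    and disj: "\<And>z z'. z \<in> Z \<Longrightarrow> z' \<in> Z \<Longrightarrow> z \<noteq> z' \<Longrightarrow> K z \<inter> K z' \<inter> D = {}"
  obtains z where "z \<in> Z" "D \<subseteq> K z"
proof -
  obtain p where "p \<in> D" using D by blast
  then obtain z where z: "z \<in> Z" "p \<in> K z" using cover by blast
  let ?B = "\<Union>z'\<in>Z - {z}. K z'"
  have "closed ?B" using Z by (intro closed_UN) auto
  moreover have "D \<subseteq> K z \<union> ?B" using cover by blast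
  moreover have "K z \<inter> ?B \<inter> D = {}" using disj[OF z(1)] by blast
  moreover have "K z \<inter> D \<noteq> {}" using z \<open>p \<in> D\<close> by blast
  ultimately have "?B \<inter> D = {}" using D(1) Z(2)[OF z(1)] unfolding connected_closed by blast
  then have "D \<subseteq> K z" using cover by blast
  then show ?thesis using that z by blast
qed

text \<open>Near a leaf \<open>x\<close> the surface minus the tree is connected, so it is covered by a single sheet of
  the unfolding, centred at a boundary point \<open>z\<close> of the polygon. If \<open>x\<close> is not a vertex, the
  surface around \<open>x\<close> has the area of a full disc, but the sheet has strictly less.\<close>

lemma leaf_is_vertex:
  fixes Q :: "(real^3) set"
  assumes Q: "polytope Q" "interior Q \<noteq> {}" and T: "T \<subseteq> frontier Q" "x \<in> T"
    and unf: "unfolds_to_simple_polygon Q T" and leaf: "conic_at T x {u}"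
  shows "x \<in> vertices_of Q"
proof (rule ccontr)
  assume "x \<notin> vertices_of Q"
  then have xne: "\<not> x extreme_point_of Q" by (simp add: vertices_of_def)
  have xfr: "x \<in> frontier Q" using T by blast
  obtain r and \<phi> :: "real^2 \<Rightarrow> real^3" and \<psi> A B where r: "r > 0" and
    \<phi>: "continuous_on UNIV \<phi>" and \<psi>: "continuous_on UNIV \<psi>" and \<psi>\<phi>: "\<And>v. \<psi> (\<phi> v) = v" and
    d\<phi>: "\<And>v. dist x (\<phi> v) = norm v" and hom: "\<And>t v. 0 \<le> t \<Longrightarrow> \<phi> (t *\<^sub>R v) = x + t *\<^sub>R (\<phi> v - x)" and
    img: "\<phi> ` ball 0 r = frontier Q \<inter> ball x r" and AB: "closed A" "closed B" "A \<union> B = UNIV" and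
    isoA: "\<And>v w. v \<in> A \<Longrightarrow> w \<in> A \<Longrightarrow> dist (\<phi> v) (\<phi> w) = dist v w" and
    isoB: "\<And>v w. v \<in> B \<Longrightarrow> w \<in> B \<Longrightarrow> dist (\<phi> v) (\<phi> w) = dist v w"
    using polytope_chart[OF Q xfr xne] by blast
  obtain P f Ps where P: "simple_polygon P" and f: "continuous_on P f" and fP: "f ` P = frontier Q"
    and ffr: "f ` frontier P = T" and inj: "inj_on f (interior P)" and fint: "f ` interior P \<inter> T = {}"
    and Ps: "finite Ps" "\<Union>Ps = P" and pieces: "\<forall>X\<in>Ps. (\<exists>F. F face_of Q \<and> aff_dim F = 2 \<and> f ` X \<subseteq> F)
       \<and> (\<forall>x\<in>X. \<forall>y\<in>X. dist (f x) (f y) = dist x y)"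
    using unf unfolding unfolds_to_simple_polygon_def by (elim exE conjE) (rule that)
  have isoPs: "dist (f y) (f y') = dist y y'" if "X \<in> Ps" "y \<in> X" "y' \<in> X" for X y y'
    using pieces that by simp
  have cP: "compact P" by (rule compact_simple_polygon[OF P])
  then have clP: "closed P" by (rule compact_imp_closed)
  have frP: "frontier P = P - interior P" using clP by (simp add: frontier_def)
  have inP: "y \<in> interior P \<longleftrightarrow> f y \<notin> T" if "y \<in> P" for y
    using that ffr fint frP by blast
  define Cs where "Cs = closure ` Ps"
  have Cs: "finite Cs" using Ps by (simp add: Cs_def)
  have Cs1: "closed X" "X \<subseteq> P" if "X \<in> Cs" for X
  proof -
    obtain X' where X': "X' \<in> Ps" "X = closure X'" using \<open>X \<in> Cs\<close> by (auto simp: Cs_def)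
    then show "closed X" "X \<subseteq> P" using closure_minimal[OF _ clP, of X'] Ps(2) by auto
  qed
  have Cs2: "\<exists>X\<in>Cs. y \<in> X" if yP: "y \<in> P" for y
  proof -
    obtain X where "X \<in> Ps" "y \<in> X" using yP Ps(2) by blast
    then show ?thesis using closure_subset[of X] unfolding Cs_def by blast
  qed
  have iso: "dist (f y) (f y') = dist y y'" if "X \<in> Cs" "y \<in> X" "y' \<in> X" for X y y'
  proof -
    obtain X' where X': "X' \<in> Ps" "X = closure X'" using \<open>X \<in> Cs\<close> by (auto simp: Cs_def)
    have "X' \<subseteq> P" using X' Ps(2) by blast
    then show ?thesis
      using isometric_on_closure[OF f clP _ isoPs[OF X'(1)]] that X' by blast
  qed
  \<comment> \<open>The possible centres of sheets over \<open>x\<close>. There are finitely many,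
    since an isometric piece contains at most one.\<close>
  define Z where "Z = {z \<in> P. f z = x}"
  have fZ: "finite Z"
  proof -
    have "Z \<subseteq> (\<Union>X\<in>Cs. X \<inter> Z)" using Cs2 by (auto simp: Z_def)
    moreover have "finite (X \<inter> Z)" if X: "X \<in> Cs" for X
    proof -
      have "z = z'" if "z \<in> X \<inter> Z" "z' \<in> X \<inter> Z" for z z'
        using iso[OF X, of z z'] that by (auto simp: Z_def)
      then have "X \<inter> Z = {} \<or> (\<exists>z. X \<inter> Z = {z})" by blast
      then show ?thesis by auto
    qed
    ultimately show ?thesis using Cs finite_subset by blast
  qed
  obtain e where nu: "norm u = 1" and e: "e > 0" "\<And>y. 0 < dist x y \<Longrightarrow> dist x y < e \<Longrightarrow> (y \<in> T \<longleftrightarrow> sgn (y - x) = u)"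
    using leaf by (auto simp: conic_at_def)
  have ev1: "\<forall>\<^sub>F \<rho> in at_right 0. f ` X \<inter> ball x \<rho> = {}" if X: "X \<in> Cs" "X \<inter> Z = {}" for X
  proof -
    have "compact X"
      using compact_Int_closed[OF cP Cs1(1)[OF X(1)]] Cs1(2)[OF X(1)] by (simp add: Int_absorb1)
    then have "compact (f ` X)"
      by (rule compact_continuous_image[OF continuous_on_subset[OF f Cs1(2)[OF X(1)]]])
    then have "open (- (f ` X))" by (simp add: compact_imp_closed open_Compl)
    moreover have "x \<in> - (f ` X)" using X Cs1(2)[OF X(1)] by (auto simp: Z_def)
    ultimately obtain b where b: "b > 0" "ball x b \<subseteq> - (f ` X)" by (meson openE)
    then have "f ` X \<inter> ball x \<rho> = {}" if "\<rho> < b" for \<rho> using that by force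
    then show ?thesis using b(1) unfolding eventually_at_right_field by blast
  qed
  have ev2: "\<forall>\<^sub>F \<rho> in at_right 0. cball z \<rho> \<inter> X = {}" if X: "X \<in> Cs" "z \<notin> X" for X z
  proof -
    have "open (- X)" using Cs1[OF X(1)] by (simp add: open_Compl)
    then obtain b where b: "b > 0" "ball z b \<subseteq> - X" using X(2) by (meson ComplI openE)
    then have "cball z \<rho> \<inter> X = {}" if "\<rho> < b" for \<rho> using that by force
    then show ?thesis using b(1) unfolding eventually_at_right_field by blast
  qed
  have ev3: "\<forall>\<^sub>F \<rho> in at_right 0. 2 * \<rho> < dist z z'" if "z \<noteq> z'" for z z' :: "real^2"
    unfolding eventually_at_right_field using that by (intro exI[of _ "dist z z' / 2"]) auto
  have ev4: "\<forall>\<^sub>F \<rho> in at_right 0. \<rho> < c" if "0 < c" for c :: real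
    unfolding eventually_at_right_field using that by blast
  \<comment> \<open>Demands on the radius: pieces without a centre have images away from
    \<open>x\<close>, pieces missing a centre also miss its closed disc, discs about different
    centres are disjoint, and the chart and the conic shape of \<open>T\<close> are both
    available.\<close>
  have "\<forall>\<^sub>F \<rho> in at_right 0. (\<forall>X\<in>{X\<in>Cs. X \<inter> Z = {}}. f ` X \<inter> ball x \<rho> = {})
      \<and> (\<forall>p\<in>{p\<in>Cs \<times> Z. snd p \<notin> fst p}. cball (snd p) \<rho> \<inter> fst p = {})
      \<and> (\<forall>p\<in>{p\<in>Z \<times> Z. fst p \<noteq> snd p}. 2 * \<rho> < dist (fst p) (snd p))
      \<and> \<rho> < r \<and> \<rho> < e \<and> 0 < \<rho>"
    using Cs fZ r e(1)
    by (intro eventually_conj eventually_ball_finite ballI ev1 ev2 ev3 ev4 eventually_at_right_less) auto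
  then obtain \<rho> where \<rho>: "\<And>X. X \<in> Cs \<Longrightarrow> X \<inter> Z = {} \<Longrightarrow> f ` X \<inter> ball x \<rho> = {}"
      "\<And>X z. X \<in> Cs \<Longrightarrow> z \<in> Z \<Longrightarrow> z \<notin> X \<Longrightarrow> cball z \<rho> \<inter> X = {}"
      "\<And>z z'. z \<in> Z \<Longrightarrow> z' \<in> Z \<Longrightarrow> z \<noteq> z' \<Longrightarrow> 2 * \<rho> < dist z z'"
      "\<rho> < r" "\<rho> < e" "0 < \<rho>"
    using eventually_happens'[OF trivial_limit_at_right_real] by (smt (verit) fst_conv mem_Collect_eq mem_Sigma_iff snd_conv)
  \<comment> \<open>A point in the closed disc about \<open>z\<close> shares a piece with
    \<open>z\<close>. Conversely, in \<open>F2\<close>, a point landing near \<open>x\<close> lies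
    in a piece with a centre.\<close>
  have F1: "dist x (f y) = dist z y" if "y \<in> P" "z \<in> Z" "dist z y \<le> \<rho>" for y z
  proof -
    from Cs2[OF that(1)] obtain X where X: "X \<in> Cs" "y \<in> X" by blast
    then have "z \<in> X" using \<rho>(2)[OF X(1) that(2)] that(3) by fastforce
    then show ?thesis using iso[OF X(1) _ X(2), of z] that by (simp add: Z_def)
  qed
  have F2: "\<exists>z\<in>Z. dist z y = dist x (f y)" if "y \<in> P" "dist x (f y) < \<rho>" for y
  proof -
    from Cs2[OF that(1)] obtain X where X: "X \<in> Cs" "y \<in> X" by blast
    have "f y \<in> f ` X \<inter> ball x \<rho>" using X that by auto
    then obtain z where z: "z \<in> X" "z \<in> Z" using \<rho>(1)[OF X(1)] by blast
    then show ?thesis using iso[OF X(1) z(1) X(2)] by (auto simp: Z_def)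
  qed
  have chart: "\<exists>v. y = \<phi> v \<and> v = \<psi> y" if "y \<in> frontier Q" "dist x y < r" for y
  proof -
    have "y \<in> \<phi> ` ball 0 r" using that img by auto
    then show ?thesis using \<psi>\<phi> by auto
  qed
  have inQ: "\<phi> v \<in> frontier Q" if "norm v < \<rho>" for v
    using img that \<rho>(4) by (metis IntD1 image_eqI mem_ball_0 order.strict_trans)
  \<comment> \<open>A sample point on the only arc of \<open>T\<close> at \<open>x\<close>; its
    chart coordinate \<open>v0\<close> spans the slit.\<close>
  define p0 where "p0 = x + (\<rho> / 2) *\<^sub>R u"
  define v0 where "v0 = \<psi> p0"
  have sp0: "sgn (p0 - x) = u" "dist x p0 = \<rho> / 2"
    using \<rho>(6) nu by (auto simp: p0_def sgn_scaleR_unit dist_norm)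
  then have dp0: "0 < dist x p0" "dist x p0 < e" "dist x p0 < r" using \<rho>(4-6) by linarith+
  have "p0 \<in> frontier Q" using e(2)[OF dp0(1,2)] sp0(1) T(1) by blast
  from chart[OF this dp0(3)] have v0: "\<phi> v0 = p0" by (auto simp: v0_def)
  have nv0: "norm v0 = \<rho> / 2" using d\<phi>[of v0] v0 sp0 by simp
  then have v0n: "v0 \<noteq> 0" using \<rho>(6) by auto
  let ?ray = "(\<lambda>t. t *\<^sub>R v0) ` {0..}"
  have ray: "\<phi> (t *\<^sub>R v0) = x + (t * (\<rho> / 2)) *\<^sub>R u" if "0 \<le> t" for t
    using hom[OF that, of v0] v0 by (simp add: p0_def)
  have F3: "\<phi> v \<in> T \<longleftrightarrow> v \<in> ?ray" if v: "norm v < \<rho>" for v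
  proof (cases "v = 0")
    case True
    have "\<phi> 0 = x" using d\<phi>[of 0] by simp
    then show ?thesis using True T(2) by (auto intro!: image_eqI[of _ _ 0])
  next
    case False
    have pos: "0 < dist x (\<phi> v)" "dist x (\<phi> v) < e" using False v \<rho> d\<phi>[of v] by auto
    show ?thesis
    proof
      assume "\<phi> v \<in> T"
      then have "sgn (\<phi> v - x) = u" using e(2)[OF pos] by blast
      then have "\<phi> v - x = norm v *\<^sub>R u"
        using norm_scaleR_sgn[of "\<phi> v - x"] d\<phi>[of v] by (simp add: dist_norm norm_minus_commute)
      moreover have "\<phi> ((2 * norm v / \<rho>) *\<^sub>R v0) = x + norm v *\<^sub>R u"
        using ray[of "2 * norm v / \<rho>"] \<rho>(6) by simp
      ultimately have "\<phi> v = \<phi> ((2 * norm v / \<rho>) *\<^sub>R v0)" by (simp add: algebra_simps)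
      then have "v = (2 * norm v / \<rho>) *\<^sub>R v0" using \<psi>\<phi> by metis
      moreover have "2 * norm v / \<rho> \<in> {0..}" using \<rho>(6) by simp
      ultimately show "v \<in> ?ray" by blast
    next
      assume "v \<in> ?ray"
      then obtain t where t: "0 \<le> t" "v = t *\<^sub>R v0" by auto
      then have "t * (\<rho> / 2) > 0" using False \<rho>(6) by (cases "t = 0") auto
      then have "sgn (\<phi> v - x) = u" using ray[OF t(1)] t(2) nu by (simp add: sgn_scaleR_unit)
      then show "\<phi> v \<in> T" using e(2)[OF pos] by blast
    qed
  qed
  \<comment> \<open>The surface near \<open>x\<close> without the tree. That \<open>x\<close> is a
    leaf enters here: a disc slit along a single ray is connected.\<close>
  define D where "D = \<phi> ` (ball 0 \<rho> - ?ray)"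
  have conD: "connected D" unfolding D_def
    by (intro connected_continuous_image connected_ball_minus_ray v0n \<rho>(6) continuous_on_subset[OF \<phi>]) auto
  have Dne: "D \<noteq> {}"
  proof -
    have "-v0 \<noteq> t *\<^sub>R v0" if "0 \<le> t" for t
    proof
      assume eq: "-v0 = t *\<^sub>R v0"
      have "(1 + t) *\<^sub>R v0 = v0 + t *\<^sub>R v0" by (simp add: scaleR_add_left)
      also have "\<dots> = v0 + (- v0)" by (simp only: eq)
      finally have "(1 + t) *\<^sub>R v0 = 0" by simp
      then show False using v0n that by simp
    qed
    then have "-v0 \<in> ball 0 \<rho> - ?ray" using nv0 \<rho>(6) by auto
    then show ?thesis unfolding D_def by blast
  qed
  have D: "y \<in> frontier Q" "y \<notin> T" "dist x y < \<rho>" if "y \<in> D" for y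
    using that inQ F3 d\<phi> by (auto simp: D_def)
  define K where "K z = f ` (P \<inter> cball z \<rho>)" for z
  have clK: "closed (K z)" for z
    unfolding K_def using cP f
    by (intro compact_imp_closed compact_continuous_image) (auto intro: continuous_on_subset compact_Int_closed)
  have cov: "\<exists>y z. y \<in> P \<and> z \<in> Z \<and> dist z y < \<rho> \<and> p = f y" if p: "p \<in> D" for p
  proof -
    obtain y where y: "y \<in> P" "p = f y" using D(1)[OF p] fP by blast
    moreover obtain z where "z \<in> Z" "dist z y = dist x (f y)" using F2[of y] D(3)[OF p] y by blast
    ultimately show ?thesis using D(3)[OF p] by (intro exI[of _ y] exI[of _ z]) simp
  qed
  have cover: "D \<subseteq> (\<Union>z\<in>Z. K z)"
  proof
    fix p assume "p \<in> D"
    from cov[OF this] obtain y z where "y \<in> P" "z \<in> Z" "dist z y < \<rho>" "p = f y" by blast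
    then have "p \<in> K z" by (simp add: K_def)
    then show "p \<in> (\<Union>z\<in>Z. K z)" using \<open>z \<in> Z\<close> by blast
  qed
  \<comment> \<open>A point of \<open>D\<close> is off \<open>T\<close>, so its preimages are
    interior to \<open>P\<close>, where \<open>f\<close> is injective; two discs would share a
    point.\<close>
  have disj: "K z \<inter> K z' \<inter> D = {}" if z: "z \<in> Z" "z' \<in> Z" "z \<noteq> z'" for z z'
  proof (rule ccontr)
    assume "K z \<inter> K z' \<inter> D \<noteq> {}"
    then obtain y y' where y: "y \<in> P" "y' \<in> P" "dist z y \<le> \<rho>" "dist z' y' \<le> \<rho>" "f y = f y'" "f y \<in> D"
      by (auto simp: K_def)
    have "y \<in> interior P" "y' \<in> interior P" using inP y D(2) by metis+
    then have "y = y'" using inj y(5) by (auto dest: inj_onD)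
    then have "dist z z' \<le> 2 * \<rho>" using y dist_triangle2[of z z' y] by (simp add: dist_commute)
    then show False using \<rho>(3)[OF z] by simp
  qed
  obtain z where z: "z \<in> Z" "D \<subseteq> K z"
    by (rule connected_subset_finite_disjoint_closed[OF conD Dne fZ clK cover disj])
  define Y where "Y = P \<inter> ball z \<rho>"
  have Ym: "Y \<in> lmeasurable"
    unfolding Y_def using fmeasurable_Int_fmeasurable[of "ball z \<rho>" lebesgue P] clP by (simp add: Int_commute)
  have subY: "ball 0 \<rho> - ?ray \<subseteq> (\<psi> \<circ> f) ` Y"
  proof
    fix v assume v: "v \<in> ball 0 \<rho> - ?ray"
    then have "\<phi> v \<in> D" by (auto simp: D_def)
    then obtain y where y: "y \<in> P" "dist z y \<le> \<rho>" "\<phi> v = f y" using z(2) by (auto simp: K_def)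
    have "dist z y < \<rho>" using F1[OF y(1) z(1) y(2)] y(3) d\<phi>[of v] v by auto
    then show "v \<in> (\<psi> \<circ> f) ` Y" using y \<psi>\<phi>[of v] by (auto simp: Y_def intro!: image_eqI[of _ _ y])
  qed
  have \<psi>f: "continuous_on P (\<psi> \<circ> f)"
    by (intro continuous_on_compose f continuous_on_subset[OF \<psi>]) auto
  \<comment> \<open>\<open>\<psi>\<close> is known to be isometric only on each half of the chart,
    so the closed pieces are refined by the preimages of \<open>A\<close> and
    \<open>B\<close>.\<close>
  define pcs where "pcs = (\<lambda>(X, H). X \<inter> (P \<inter> (\<psi> \<circ> f) -` H)) ` (Cs \<times> {A, B})"
  have "(\<psi> \<circ> f) ` Y \<in> lmeasurable \<and> measure lebesgue ((\<psi> \<circ> f) ` Y) \<le> measure lebesgue Y"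
  proof (rule measure_piecewise_isometric_image)
    show "finite pcs" using Cs by (simp add: pcs_def)
    show "closed X" if "X \<in> pcs" for X
      using that AB Cs1(1) continuous_closed_preimage[OF \<psi>f clP] by (auto simp: pcs_def)
    show "Y \<in> lmeasurable" by (rule Ym)
    show "Y \<subseteq> \<Union>pcs"
    proof
      fix y assume y: "y \<in> Y"
      then obtain X where X: "X \<in> Cs" "y \<in> X" using Cs2 by (auto simp: Y_def)
      obtain H where H: "H \<in> {A, B}" "(\<psi> \<circ> f) y \<in> H" using AB(3) by blast
      have "y \<in> X \<inter> (P \<inter> (\<psi> \<circ> f) -` H)" using y X H by (auto simp: Y_def)
      then show "y \<in> \<Union>pcs" using X H unfolding pcs_def by blast
    qed
    fix X y y' assume X: "X \<in> pcs" and y: "y \<in> X \<inter> Y" "y' \<in> X \<inter> Y"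
    obtain X' H where X': "X' \<in> Cs" "H \<in> {A, B}" "X = X' \<inter> (P \<inter> (\<psi> \<circ> f) -` H)"
      using X by (auto simp: pcs_def)
    have fy: "\<phi> (\<psi> (f w)) = f w" if w: "w \<in> Y" for w
    proof -
      have "w \<in> P" "dist z w \<le> \<rho>" "dist z w < \<rho>" using w by (auto simp: Y_def)
      then have "f w \<in> frontier Q" "dist x (f w) < r" using fP F1[of w z] z(1) \<rho>(4) by auto
      then show ?thesis using chart by metis
    qed
    have "dist (\<psi> (f y)) (\<psi> (f y')) = dist (\<phi> (\<psi> (f y))) (\<phi> (\<psi> (f y')))"
      using X' y isoA isoB by auto
    also have "\<dots> = dist y y'" using fy y X' iso[OF X'(1), of y y'] by auto
    finally show "dist ((\<psi> \<circ> f) y) ((\<psi> \<circ> f) y') = dist y y'" by simp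
  qed
  then have le: "measure lebesgue ((\<psi> \<circ> f) ` Y) \<le> measure lebesgue Y" "(\<psi> \<circ> f) ` Y \<in> lmeasurable" by auto
  \<comment> \<open>Removing the slit costs no area. The last inequality is strict because
    \<open>f z = x\<close> lies in \<open>T\<close>, so \<open>z\<close> is not interior to
    \<open>P\<close>.\<close>
  have "measure lebesgue (ball z \<rho>) = measure lebesgue (ball (0::real^2) \<rho>)"
    using measure_translation[of z "ball 0 \<rho>"] ball_translation[of z 0 \<rho>] by simp
  also have "\<dots> = measure lebesgue (ball 0 \<rho> - ?ray)"
    by (intro measure_negligible_symdiff[symmetric] negligible_subset[OF negligible_ray[of v0 "{0..}"]]) auto
  also have "\<dots> \<le> measure lebesgue ((\<psi> \<circ> f) ` Y)"
    using subY le(2) negligible_ray[of v0 "{0..}"]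
    by (intro measure_mono_fmeasurable) (auto intro: negligible_imp_sets)
  also have "\<dots> \<le> measure lebesgue Y" by (rule le)
  also have "\<dots> < measure lebesgue (ball z \<rho>)"
    unfolding Y_def using z(1) inP T(2) by (intro measure_ball_Int_less clP \<rho>(6)) (auto simp: Z_def)
  finally show False by simp
qed

section \<open>Counting\<close>

text \<open>Leaves are vertices, so the remaining nodes are branch points, at most as many as
  leaves. The extra 1 allows for a tree that is a single point, of degree 0.\<close>

lemma card_ct_nodes:
  assumes Q: "polytope Q" "aff_dim Q = 3" and T: "cut_tree Q T"
  shows "finite (ct_nodes Q T - vertices_of Q)"
    and "card (ct_nodes Q T - vertices_of Q) \<le> card (vertices_of Q) + 1"
proof -
  let ?V = "vertices_of Q"
  have T': "T \<subseteq> frontier Q" "polygonal_set T" "connected T" "unfolds_to_simple_polygon Q T"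
    "\<nexists>g. simple_path g \<and> pathfinish g = pathstart g \<and> path_image g \<subseteq> T"
    using T by (auto simp: cut_tree_def)
  interpret polygonal T by unfold_locales (rule T'(2))
  have intQ: "interior Q \<noteq> {}"
  proof -
    have "affine hull Q = UNIV" using aff_dim_eq_full[of Q] Q(2) by simp
    then have "interior Q = rel_interior Q" by (simp add: rel_interior_interior)
    moreover have "Q \<noteq> {}" using Q(2) by auto
    ultimately show ?thesis using rel_interior_eq_empty[OF polytope_imp_convex[OF Q(1)]] by simp
  qed
  let ?B = "{x \<in> T. 3 \<le> card (dirs T x)}" and ?L = "{x \<in> T. card (dirs T x) = 1}"
    and ?I = "{x \<in> T. dirs T x = {}}"
  have LV: "?L \<subseteq> ?V"
  proof
    fix x assume "x \<in> ?L"
    then obtain u where "x \<in> T" "dirs T x = {u}" by (auto simp: card_1_singleton_iff)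
    then have "conic_at T x {u}" using conic_at_polygonal[OF T'(2), of x] by simp
    then show "x \<in> ?V" by (rule leaf_is_vertex[OF Q(1) intQ T'(1) \<open>x \<in> T\<close> T'(4)])
  qed
  have B: "finite ?B" "card ?B \<le> card ?L"
    using card_branch_points_le_leaves[OF T'(3,5)] by auto
  have "card ?L \<le> card ?V" by (rule card_mono[OF finite_vertices_of[OF Q(1)] LV])
  have I: "finite ?I \<and> card ?I \<le> 1"
  proof (cases "?I = {}")
    case False
    then obtain x where x: "x \<in> T" "dirs T x = {}" by blast
    then have "?I \<subseteq> {x}" using isolated_point[OF T'(3)] by blast
    then show ?thesis using card_mono[of "{x}" ?I] finite_subset[of ?I "{x}"] by simp
  next
    case True
    show ?thesis unfolding True by simp
  qed
  have sub: "ct_nodes Q T - ?V \<subseteq> ?B \<union> ?I"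
  proof
    fix x assume x: "x \<in> ct_nodes Q T - ?V"
    then have xT: "x \<in> T" "card (dirs T x) \<noteq> 2" using tdeg_eq_card_dirs[OF T'(2)] by (auto simp: ct_nodes_def)
    have "card (dirs T x) \<noteq> 1" using x xT LV by blast
    then have "card (dirs T x) = 0 \<or> 3 \<le> card (dirs T x)" using xT by linarith
    then show "x \<in> ?B \<union> ?I" using xT finite_dirs by auto
  qed
  have fin: "finite (?B \<union> ?I)" using B I by simp
  show "finite (ct_nodes Q T - ?V)" by (rule finite_subset[OF sub fin])
  have "card (ct_nodes Q T - ?V) \<le> card (?B \<union> ?I)" by (rule card_mono[OF fin sub])
  also have "\<dots> \<le> card ?B + card ?I" by (rule card_Un_le)
  finally show "card (ct_nodes Q T - ?V) \<le> card ?V + 1" using B I \<open>card ?L \<le> card ?V\<close> by linarith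
qed

section \<open>Coding combinatorial cut trees by finite relations\<close>

text \<open>Nodes are renamed injectively, a vertex of \<open>Q\<close> by itself and any other node
  by a symbol. If the renamed graphs agree, matching equal names is an isomorphism, and the
  \<open>Inl\<close> names force it to respect labels.\<close>

lemma comb_equivI:
  fixes e1 e2 :: "real^3 \<Rightarrow> (real^3) + 'b"
  assumes e1: "inj_on e1 (ct_nodes Q T1)" and e2: "inj_on e2 (ct_nodes Q T2)"
    and img: "e1 ` ct_nodes Q T1 = e2 ` ct_nodes Q T2"
    and adj: "{(e1 x, e1 y) |x y. ct_adj Q T1 x y} = {(e2 x, e2 y) |x y. ct_adj Q T2 x y}"
    and l1: "\<And>x v. e1 x = Inl v \<longleftrightarrow> x \<in> vertices_of Q \<and> v = x"
    and l2: "\<And>x v. e2 x = Inl v \<longleftrightarrow> x \<in> vertices_of Q \<and> v = x"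
  shows "comb_equiv Q T1 T2"
proof -
  let ?N1 = "ct_nodes Q T1" and ?N2 = "ct_nodes Q T2"
  define h where "h = inv_into ?N2 e2 \<circ> e1"
  have h: "h x \<in> ?N2" "e2 (h x) = e1 x" if "x \<in> ?N1" for x
  proof -
    have "e1 x \<in> e2 ` ?N2" using that img by blast
    then show "h x \<in> ?N2" "e2 (h x) = e1 x"
      unfolding h_def comp_def by (rule inv_into_into, rule f_inv_into_f)
  qed
  have bij: "bij_betw h ?N1 ?N2" unfolding h_def
  proof (rule bij_betw_trans)
    show "bij_betw e1 ?N1 (e2 ` ?N2)" using e1 img by (simp add: bij_betw_def)
    show "bij_betw (inv_into ?N2 e2) (e2 ` ?N2) ?N2"
      by (rule bij_betw_inv_into) (simp add: bij_betw_def e2)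
  qed
  have A: "ct_adj Q T x y \<longleftrightarrow> (e x, e y) \<in> {(e x, e y) |x y. ct_adj Q T x y}"
    if e: "inj_on e (ct_nodes Q T)" and xy: "x \<in> ct_nodes Q T" "y \<in> ct_nodes Q T"
    for e :: "real^3 \<Rightarrow> (real^3) + 'b" and T x y
  proof
    assume "(e x, e y) \<in> {(e x, e y) |x y. ct_adj Q T x y}"
    then obtain x' y' where *: "e x = e x'" "e y = e y'" "ct_adj Q T x' y'" by auto
    then have "x' \<in> ct_nodes Q T" "y' \<in> ct_nodes Q T" by (auto simp: ct_adj_def)
    then have "x = x'" "y = y'" using e xy * by (auto dest: inj_onD)
    then show "ct_adj Q T x y" using * by simp
  qed auto
  have "ct_adj Q T1 x y \<longleftrightarrow> ct_adj Q T2 (h x) (h y)" if "x \<in> ?N1" "y \<in> ?N1" for x y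
    using A[OF e1 that] A[OF e2 h(1)[OF that(1)] h(1)[OF that(2)]] h(2) that adj by simp
  moreover have "ct_label Q (h x) = ct_label Q x" if x: "x \<in> ?N1" for x
  proof (cases "x \<in> vertices_of Q")
    case True
    then have "e2 (h x) = Inl x" using l1 h(2)[OF x] by simp
    then have "h x = x" using l2[of "h x" x] by simp
    then show ?thesis by simp
  next
    case False
    have "h x \<notin> vertices_of Q"
    proof
      assume "h x \<in> vertices_of Q"
      then have "e1 x = Inl (h x)" using l2[of "h x" "h x"] h(2)[OF x] by simp
      then show False using l1[of x "h x"] False by simp
    qed
    then show ?thesis using False by (simp add: ct_label_def)
  qed
  ultimately show ?thesis unfolding comb_equiv_def using bij by blast
qed

lemma card_comb_distinct_cut_trees:
  assumes Q: "polytope Q" "aff_dim Q = 3" and S: "S \<subseteq> {T. cut_tree Q T}"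
    and dist: "pairwise (\<lambda>T1 T2. \<not> comb_equiv Q T1 T2) S"
  shows "finite S \<and> card S \<le> 2 ^ (12 * (card (vertices_of Q))\<^sup>2)"
proof -
  let ?V = "vertices_of Q"
  define n where "n = card ?V"
  have fV: "finite ?V" by (rule finite_vertices_of[OF Q(1)])
  have "?V \<noteq> {}" using polytope_eq_hull_vertices[OF Q(1)] Q(2) by auto
  then have n: "n \<ge> 1" using fV by (simp add: n_def Suc_le_eq card_gt_0_iff)
  have "\<exists>i. inj_on i (ct_nodes Q T - ?V) \<and> i ` (ct_nodes Q T - ?V) \<subseteq> {..<n + 1}" if "T \<in> S" for T
    using inj_on_iff_card_le[of "ct_nodes Q T - ?V" "{..<n + 1}"] card_ct_nodes[OF Q, of T] that S
    by (auto simp: n_def)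
  then obtain i :: "(real^3) set \<Rightarrow> real^3 \<Rightarrow> nat" where
    i: "\<And>T. T \<in> S \<Longrightarrow> inj_on (i T) (ct_nodes Q T - ?V)"
       "\<And>T. T \<in> S \<Longrightarrow> i T ` (ct_nodes Q T - ?V) \<subseteq> {..<n + 1}" by metis
  \<comment> \<open>Vertices keep their identity, which encodes the label; the at most
    \<open>n + 1\<close> other nodes receive numbers.\<close>
  define e where "e T x = (if x \<in> ?V then Inl x else Inr (i T x))" for T x
  define code where "code T = (e T ` ct_nodes Q T, {(e T x, e T y) |x y. ct_adj Q T x y})" for T
  define A :: "((real^3) + nat) set" where "A = Inl ` ?V \<union> Inr ` {..<n + 1}"
  have eA: "e T x \<in> A" if "T \<in> S" "x \<in> ct_nodes Q T" for T x
    using i(2)[OF that(1)] that(2) by (auto simp: e_def A_def)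
  have fA: "finite A" using fV by (simp add: A_def)
  have cA: "card A \<le> 2 * n + 1"
  proof -
    have "card A \<le> card (Inl ` ?V :: ((real^3) + nat) set) + card (Inr ` {..<n + 1} :: ((real^3) + nat) set)"
      unfolding A_def by (rule card_Un_le)
    also have "\<dots> \<le> n + (n + 1)"
      using card_image_le[OF fV, of Inl] card_image_le[of "{..<n + 1}" Inr] unfolding n_def by (intro add_mono) auto
    finally show ?thesis by simp
  qed
  have inj_e: "inj_on (e T) (ct_nodes Q T)" if "T \<in> S" for T
    using i(1)[OF that] by (auto simp: inj_on_def e_def)
  have l: "e T x = Inl v \<longleftrightarrow> x \<in> ?V \<and> v = x" for T x v by (auto simp: e_def)
  have inj: "inj_on code S"
  proof (rule inj_onI, rule ccontr)
    fix T1 T2 assume T: "T1 \<in> S" "T2 \<in> S" "code T1 = code T2" "T1 \<noteq> T2"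
    have "comb_equiv Q T1 T2"
      using T(3) by (intro comb_equivI[OF inj_e[OF T(1)] inj_e[OF T(2)] _ _ l l]) (simp_all add: code_def)
    then show False using dist T by (auto simp: pairwise_def)
  qed
  have sub: "code ` S \<subseteq> Pow A \<times> Pow (A \<times> A)"
    using eA by (auto simp: code_def ct_adj_def)
  have fin: "finite (Pow A \<times> Pow (A \<times> A))" using fA by simp
  have "finite S" "card S \<le> card (Pow A \<times> Pow (A \<times> A))"
    using inj_on_finite[OF inj sub fin] card_inj_on_le[OF inj sub fin] .
  moreover have "card (Pow A \<times> Pow (A \<times> A)) = 2 ^ (card A + card A * card A)"
    using fA by (simp add: card_cartesian_product card_Pow power_add)
  moreover have "(2::nat) ^ (card A + card A * card A) \<le> 2 ^ (12 * n\<^sup>2)"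
  proof (rule power_increasing)
    \<comment> \<open>\<open>n \<ge> 1\<close> absorbs the summand 1 here, and below the linear term
      into the quadratic one.\<close>
    have a: "card A \<le> 3 * n" using cA n by linarith
    have "card A + card A * card A \<le> 3 * n + (3 * n) * (3 * n)" using a by (intro add_mono mult_mono) auto
    also have "\<dots> \<le> 3 * (n * n) + (3 * n) * (3 * n)" using n by simp
    also have "\<dots> = 12 * n\<^sup>2" by (simp add: power2_eq_square)
    finally show "card A + card A * card A \<le> 12 * n\<^sup>2" .
  qed simp
  ultimately show ?thesis unfolding n_def by linarith
qed

text \<open>Trees are counted as point sets, which bounds the number of classes as well.\<close>

lemma card_edge_cut_trees:
  assumes Q: "polytope Q" "aff_dim Q = 3" and S: "S \<subseteq> {T. edge_cut_tree Q T}"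
  shows "finite S \<and> card S \<le> 2 ^ (6 * card (vertices_of Q))"
proof -
  have sub: "S \<subseteq> Union ` Pow (edges_of Q)" using S by (auto simp: edge_cut_tree_def)
  have fin: "finite (Pow (edges_of Q))" using finite_edges_of[OF Q(1)] by simp
  have "card S \<le> card (Union ` Pow (edges_of Q))" by (rule card_mono[OF finite_imageI[OF fin] sub])
  also have "\<dots> \<le> card (Pow (edges_of Q))" by (rule card_image_le[OF fin])
  also have "\<dots> = 2 ^ card (edges_of Q)" using finite_edges_of[OF Q(1)] by (simp add: card_Pow)
  also have "\<dots> \<le> 2 ^ (6 * card (vertices_of Q))" using card_edges_le[OF Q] by (intro power_increasing) auto
  finally show ?thesis using finite_subset[OF sub finite_imageI[OF fin]] by blast
qed

theorem theorem12:
  shows "(\<exists>C::nat. \<forall>(Q::(real^3) set) S.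
            polytope Q \<and> aff_dim Q = 3 \<and> S \<subseteq> {T. edge_cut_tree Q T}
            \<and> pairwise (\<lambda>T1 T2. \<not> comb_equiv Q T1 T2) S
            \<longrightarrow> finite S \<and> card S \<le> 2 ^ (C * card (vertices_of Q)))
       \<and> (\<exists>C::nat. \<forall>(Q::(real^3) set) S.
            polytope Q \<and> aff_dim Q = 3 \<and> S \<subseteq> {T. cut_tree Q T}
            \<and> pairwise (\<lambda>T1 T2. \<not> comb_equiv Q T1 T2) S
            \<longrightarrow> finite S \<and> card S \<le> 2 ^ (C * (card (vertices_of Q))\<^sup>2))"
proof
  show "\<exists>C::nat. \<forall>(Q::(real^3) set) S.
            polytope Q \<and> aff_dim Q = 3 \<and> S \<subseteq> {T. edge_cut_tree Q T}
            \<and> pairwise (\<lambda>T1 T2. \<not> comb_equiv Q T1 T2) S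
            \<longrightarrow> finite S \<and> card S \<le> 2 ^ (C * card (vertices_of Q))"
    using card_edge_cut_trees by (intro exI[of _ 6]) blast
  show "\<exists>C::nat. \<forall>(Q::(real^3) set) S.
            polytope Q \<and> aff_dim Q = 3 \<and> S \<subseteq> {T. cut_tree Q T}
            \<and> pairwise (\<lambda>T1 T2. \<not> comb_equiv Q T1 T2) S
            \<longrightarrow> finite S \<and> card S \<le> 2 ^ (C * (card (vertices_of Q))\<^sup>2)"
    using card_comb_distinct_cut_trees by (intro exI[of _ 12]) blast
qed

end
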